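(* Let $T>0$, let $n\ge1$ be an integer, $h=T/n$, $t_k=kh$ for $k=0,\dots,n$, and let $b:\mathbb{R}^d\to\mathbb{R}^d$ and $\sigma:\mathbb{R}^d\to\mathbb{R}^{d\times q}$. Let $P$ be the transition of the Euler scheme with step $h$, $$Pf(x)=\mathbb{E}\,f\big(x+h\,b(x)+\sqrt h\,\sigma(x)Z\big),\qquad Z\sim\mathcal{N}(0,I_q).$$ Assume that $b$ and $\sigma$ are twice differentiable and that $Db$, $D^2b$, $D\sigma$ and all the matrix-valued functions $(\partial^2_{x_ix_j}\sigma)\sigma^*$, $i,j\in\{1,\dots,d\}$, are bounded. Let $f:\mathbb{R}^d\to\mathbb{R}$ be twice differentiable with a Lipschitz gradient. (a) There exists a real constant $C>0$, depending only on $T$ and on the bounds of $Db$, $D^2b$, $D\sigma$ and $(D^2\sigma)\sigma^*$, and not depending on $h$, such that $$[Pf]_{\rm Lip}\le(1+Ch)[f]_{\rm Lip}\qquad\text{and}\qquad[\nabla Pf]_{\rm Lip}\le(1+Ch)[\nabla f]_{\rm Lip}+h\,\|D^2b\|_{\sup}\,\|\nabla f\|_{\sup}.$$ (b) As a consequence, for every $k\in\{0,\dots,n\}$, $$[\nabla P^kf]_{\rm Lip}\le e^{Ct_k}\Big([\nabla f]_{\rm Lip}+t_k\,\|D^2b\|_{\sup}\,\|\nabla f\|_{\sup}\Big).$$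
   Context: $[g]_{\rm Lip}\in[0,+\infty]$ is the Lipschitz constant of $g$ with respect to Euclidean norms; $\|g\|_{\sup}\in[0,+\infty]$ is the supremum of the (Euclidean, respectively operator) norm of $g$; $\|D^2b\|_{\sup}=\sup_x\sup_{|u|,|v|\le1}|D^2b(x)(u,v)|$. $\sigma^*$ is the transpose of $\sigma$. $P^k$ is the $k$-th iterate of $P$. The bounds in the inequalities are understood in $[0,+\infty]$. *)

theory Defs
  imports "HOL-Probability.Probability"
begin

definition lip_const :: "('a::metric_space \<Rightarrow> 'b::metric_space) \<Rightarrow> ennreal" where
  "lip_const g = (SUP x. SUP y\<in>-{x}. ennreal (dist (g x) (g y) / dist x y))"

definition sup_norm :: "('a \<Rightarrow> 'b::real_normed_vector) \<Rightarrow> ennreal" where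
  "sup_norm g = (SUP x. ennreal (norm (g x)))"

text \<open>The norm of the type \<open>real^'q^'d\<close> is the Frobenius norm, so the operator norm of a
  matrix is written with \<^const>\<open>onorm\<close>.\<close>

definition sup_opnorm :: "('a \<Rightarrow> real^'q^'d) \<Rightarrow> ennreal" where
  "sup_opnorm A = (SUP x. ennreal (onorm ((*v) (A x))))"

definition grad :: "('a::real_inner \<Rightarrow> real) \<Rightarrow> 'a \<Rightarrow> 'a" where
  "grad f x = (THE D. GDERIV f x :> D)"

definition fderiv :: "('a::real_normed_vector \<Rightarrow> 'b::real_normed_vector) \<Rightarrow> 'a \<Rightarrow> 'a \<Rightarrow>\<^sub>L 'b" where
  "fderiv g x = Blinfun (frechet_derivative g (at x))"

definition twice_differentiable :: "('a::real_normed_vector \<Rightarrow> 'b::real_normed_vector) \<Rightarrow> bool" where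
  "twice_differentiable g \<longleftrightarrow>
     (\<forall>x. g differentiable (at x)) \<and> (\<forall>x. fderiv g differentiable (at x))"

definition D2 :: "('a::real_normed_vector \<Rightarrow> 'b::real_normed_vector) \<Rightarrow> 'a \<Rightarrow> 'a \<Rightarrow> 'a \<Rightarrow> 'b" where
  "D2 g x u v = blinfun_apply (blinfun_apply (fderiv (fderiv g) x) u) v"

definition D2_sup :: "('a::real_normed_vector \<Rightarrow> 'b::real_normed_vector) \<Rightarrow> ennreal" where
  "D2_sup g = (SUP x. SUP u\<in>cball 0 1. SUP v\<in>cball 0 1. ennreal (norm (D2 g x u v)))"

definition partial2 :: "'d \<Rightarrow> 'd \<Rightarrow> (real^'d \<Rightarrow> 'b::real_normed_vector) \<Rightarrow> real^'d \<Rightarrow> 'b" where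
  "partial2 i j g x = D2 g x (axis i 1) (axis j 1)"

definition D_sup_opnorm :: "('a::real_normed_vector \<Rightarrow> real^'q^'d) \<Rightarrow> ennreal" where
  "D_sup_opnorm s =
     (SUP x. SUP u\<in>cball 0 1. ennreal (onorm ((*v) (blinfun_apply (fderiv s x) u))))"

text \<open>The law \<open>N(0, I)\<close>: independent standard normal coordinates.\<close>

definition std_gaussian :: "(real^'q) measure" where
  "std_gaussian = density lborel (\<lambda>z. ennreal (\<Prod>i\<in>UNIV. std_normal_density (z $ i)))"

definition euler_step ::
  "real \<Rightarrow> (real^'d \<Rightarrow> real^'d) \<Rightarrow> (real^'d \<Rightarrow> real^'q^'d) \<Rightarrow> real^'d \<Rightarrow> real^'q \<Rightarrow> real^'d" where
  "euler_step h b s x z = x + h *\<^sub>R b x + sqrt h *\<^sub>R (s x *v z)"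

definition euler_trans ::
  "real \<Rightarrow> (real^'d \<Rightarrow> real^'d) \<Rightarrow> (real^'d \<Rightarrow> real^'q^'d) \<Rightarrow>
   (real^'d \<Rightarrow> real) \<Rightarrow> real^'d \<Rightarrow> real" where
  "euler_trans h b s f x = (\<integral>z. f (euler_step h b s x z) \<partial>std_gaussian)"

end

theory Submission imports Defs begin

text \<open>
  Write \<open>E x z\<close> for the Euler step and \<open>DE x z u\<close> for its derivative in direction \<open>u\<close>. Then
  \<open>\<nabla>(P f)(x) \<bullet> v\<close> is the expectation of \<open>\<nabla>f(E x Z) \<bullet> DE x Z v\<close>, and its derivative in direction \<open>u\<close> is
  the expectation of \<open>D\<^sup>2f(E x Z)(DE x Z u, DE x Z v)\<close> plus that of
  \<open>\<nabla>f(E x Z) \<bullet> (h D\<^sup>2b(x)(u,v) + \<surd>h D\<^sup>2\<sigma>(x)(u,v) Z)\<close>. The first is controlled by the second moment of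
  \<open>DE x Z u\<close>, which is \<open>1 + O(h)\<close>; the \<open>b\<close>-term gives \<open>h \<parallel>D\<^sup>2b\<parallel> \<parallel>\<nabla>f\<parallel>\<close>; the \<open>\<sigma>\<close>-term, apparently of
  order \<open>\<surd>h\<close>, is by Gaussian integration by parts \<open>h\<close> times the expectation of the trace of \<open>D\<^sup>2f\<close>
  against \<open>(D\<^sup>2\<sigma>) \<sigma>\<^sup>*\<close>.

  Since \<open>D\<^sup>2\<sigma>\<close> alone need not be locally bounded, all differentiations under the integral sign use
  only the differentiability of \<open>D\<sigma>\<close> at the given point. If \<open>\<parallel>D\<^sup>2b\<parallel> \<parallel>\<nabla>f\<parallel> = \<infinity>\<close>, the iterates need not have
  Lipschitz gradients; their differentiability then comes from the linear growth of the gradient,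
  which \<open>P\<close> preserves.
\<close>

section \<open>Differentiation under the integral sign\<close>

text \<open>Increments are dominated only from the single point \<open>x0\<close>, not between
  nearby points and not through derivatives near \<open>x0\<close>. This suffices for dominated
  convergence of the difference quotients at \<open>x0\<close>, and the bound passes to
  \<open>F'\<close> in the limit.\<close>

lemma
  fixes F :: "'a::euclidean_space \<Rightarrow> 'z \<Rightarrow> real"
  assumes int: "\<And>x. integrable M (F x)"
    and deriv: "\<And>z. ((\<lambda>x. F x z) has_derivative F' z) (at x0)"
    and lip: "eventually (\<lambda>x. \<forall>z. \<bar>F x z - F x0 z\<bar> \<le> K z * norm (x - x0)) (at x0)"
    and K: "integrable M K"
  shows integrable_derivative_dominated: "integrable M (\<lambda>z. F' z u)"
    and has_derivative_integral_dominated: "((\<lambda>x. \<integral>z. F x z \<partial>M) has_derivative (\<lambda>u. \<integral>z. F' z u \<partial>M)) (at x0)"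
proof -
  note [measurable] = borel_measurable_integrable[OF int] borel_measurable_integrable[OF K]
  obtain d where d: "d > 0" "\<And>x z. x \<noteq> x0 \<Longrightarrow> dist x x0 < d \<Longrightarrow> \<bar>F x z - F x0 z\<bar> \<le> K z * norm (x - x0)"
    using lip unfolding eventually_at by auto
  have lin: "linear (F' z)" for z
    using deriv[of z] by (rule has_derivative_linear)
  have lim: "((\<lambda>t. (F (x0 + t *\<^sub>R u) z - F x0 z) / t) \<longlongrightarrow> F' z u) (at_right 0)" for u z
  proof -
    have "((\<lambda>t. F (x0 + t *\<^sub>R u) z) has_derivative (\<lambda>t. F' z (t *\<^sub>R u))) (at 0)"
      by (rule has_derivative_compose[of "\<lambda>t. x0 + t *\<^sub>R u" "\<lambda>t. t *\<^sub>R u" 0 UNIV "\<lambda>x. F x z", simplified])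
         (auto intro!: derivative_eq_intros deriv)
    then have "((\<lambda>t. F (x0 + t *\<^sub>R u) z) has_field_derivative F' z u) (at 0)"
      unfolding has_field_derivative_def using linear_cmul[OF lin] by (simp add: mult.commute[of _ "F' z u"])
    then show ?thesis
      unfolding DERIV_def by (auto simp: filterlim_at_split)
  qed
  \<comment> \<open>A countable sequence of difference quotients is what makes \<open>F' z u\<close>
    measurable in \<open>z\<close>.\<close>
  have seq: "(\<lambda>n. (F (x0 + inverse (real (Suc n)) *\<^sub>R u) z - F x0 z) / inverse (real (Suc n)))
      \<longlonglongrightarrow> F' z u" for u z
    by (rule filterlim_compose[OF lim])
       (use LIMSEQ_inverse_real_of_nat in \<open>auto simp: filterlim_at\<close>)
  have meas [measurable]: "(\<lambda>z. F' z u) \<in> borel_measurable M" for u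
    by (rule borel_measurable_LIMSEQ_real[OF seq]) measurable
  have bound: "\<bar>F' z u\<bar> \<le> K z * norm u" for z u
  proof (rule tendsto_upperbound[OF tendsto_rabs[OF lim]])
    show "eventually (\<lambda>t. \<bar>(F (x0 + t *\<^sub>R u) z - F x0 z) / t\<bar> \<le> K z * norm u) (at_right 0)"
    proof (cases "u = 0")
      case False
      show ?thesis unfolding eventually_at
      proof (intro exI[of _ "d / norm u"] conjI ballI impI)
        fix t :: real assume t: "t \<in> {0<..}" "t \<noteq> 0 \<and> dist t 0 < d / norm u"
        then show "\<bar>(F (x0 + t *\<^sub>R u) z - F x0 z) / t\<bar> \<le> K z * norm u"
          using d(2)[of "x0 + t *\<^sub>R u" z] False by (auto simp: dist_norm field_simps)
      qed (use d False in auto)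
    qed auto
  qed simp
  show int': "integrable M (\<lambda>z. F' z u)" for u
    by (rule Bochner_Integration.integrable_bound[OF integrable_mult_left[OF K, of "norm u"]])
       (measurable, intro AE_I2, simp only: real_norm_def, rule order_trans[OF bound abs_ge_self])
  have "linear (\<lambda>u. \<integral>z. F' z u \<partial>M)"
    by (rule linearI) (simp_all add: linear_add[OF lin] linear_cmul[OF lin] int')
  then have bl: "bounded_linear (\<lambda>u. \<integral>z. F' z u \<partial>M)"
    by (simp add: linear_conv_bounded_linear)
  show "((\<lambda>x. \<integral>z. F x z \<partial>M) has_derivative (\<lambda>u. \<integral>z. F' z u \<partial>M)) (at x0)"
    unfolding has_derivative_iff_norm
  \<comment> \<open>The remainder is tested along arbitrary sequences, since dominated convergence
    is sequential.\<close>
  proof (intro conjI bl, unfold tendsto_at_iff_sequentially, intro allI impI)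
    fix X :: "nat \<Rightarrow> 'a" assume X: "\<forall>i. X i \<in> UNIV - {x0}" "X \<longlonglongrightarrow> x0"
    let ?R = "\<lambda>x z. (F x z - F x0 z - F' z (x - x0)) / norm (x - x0)"
    have pw: "(\<lambda>n. ?R (X n) z) \<longlonglongrightarrow> 0" for z
    proof -
      have "((\<lambda>x. norm (F x z - F x0 z - F' z (x - x0)) / norm (x - x0)) \<longlongrightarrow> 0) (at x0)"
        using deriv[of z] unfolding has_derivative_iff_norm by auto
      then have "(\<lambda>n. norm (?R (X n) z)) \<longlonglongrightarrow> 0"
        using X unfolding tendsto_at_iff_sequentially by (auto simp: o_def abs_divide)
      then show ?thesis by (rule tendsto_norm_zero_cancel)
    qed
    obtain N where N: "\<And>n. n \<ge> N \<Longrightarrow> dist (X n) x0 < d"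
      using X(2) d(1) unfolding lim_sequentially by blast
    \<comment> \<open>The offset \<open>N\<close> brings the sequence into the ball where the
      increment bound holds. The majorant \<open>2 * K z\<close> takes one \<open>K z\<close> from
      the increment and one from \<open>F'\<close>.\<close>
    have "(\<lambda>n. \<integral>z. ?R (X (n + N)) z \<partial>M) \<longlonglongrightarrow> (\<integral>z. 0 \<partial>M)"
    proof (rule integral_dominated_convergence)
      show "integrable M (\<lambda>z. 2 * K z)" using K by simp
      show "AE z in M. (\<lambda>n. ?R (X (n + N)) z) \<longlonglongrightarrow> 0"
        using LIMSEQ_ignore_initial_segment[OF pw] by simp
      fix n
      show "AE z in M. norm (?R (X (n + N)) z) \<le> 2 * K z"
      proof (rule AE_I2)
        fix z
        have ne: "norm (X (n + N) - x0) > 0" using X(1) by auto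
        have "\<bar>F (X (n + N)) z - F x0 z - F' z (X (n + N) - x0)\<bar> \<le> 2 * K z * norm (X (n + N) - x0)"
          using d(2)[of "X (n + N)" z] N[of "n + N"] X(1) bound[of z "X (n + N) - x0"] by auto
        with ne show "norm (?R (X (n + N)) z) \<le> 2 * K z"
          by (auto simp: abs_divide divide_simps mult.commute)
      qed
    qed measurable
    then have "(\<lambda>n. \<integral>z. ?R (X n) z \<partial>M) \<longlonglongrightarrow> 0"
      by (simp add: LIMSEQ_offset)
    then have "(\<lambda>n. norm (\<integral>z. ?R (X n) z \<partial>M)) \<longlonglongrightarrow> 0"
      by (rule tendsto_norm_zero)
    moreover have "norm (\<integral>z. ?R x z \<partial>M) =
       norm ((\<integral>z. F x z \<partial>M) - (\<integral>z. F x0 z \<partial>M) - (\<integral>z. F' z (x - x0) \<partial>M)) / norm (x - x0)" for x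
      using int int' by (simp add: abs_divide)
    ultimately show "((\<lambda>x. norm ((\<integral>z. F x z \<partial>M) - (\<integral>z. F x0 z \<partial>M) - (\<integral>z. F' z (x - x0) \<partial>M)) / norm (x - x0)) \<circ> X) \<longlonglongrightarrow> 0"
      by (simp only: o_def)
  qed
qed

section \<open>The standard Gaussian measure\<close>

lemma sets_std_gaussian [measurable_cong, simp]: "sets std_gaussian = sets borel"
  by (simp add: std_gaussian_def)

lemma space_std_gaussian [simp]: "space std_gaussian = UNIV"
  by (simp add: std_gaussian_def)

lemma nn_integral_lborel_vec_prod:
  fixes f :: "real \<Rightarrow> ennreal"
  assumes "f \<in> borel_measurable borel"
  shows "(\<integral>\<^sup>+z. (\<Prod>i\<in>UNIV. f (z $ i)) \<partial>(lborel :: (real^'q) measure)) = (\<integral>\<^sup>+x. f x \<partial>lborel) ^ CARD('q)"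
proof -
  have B: "(Basis :: (real^'q) set) = (\<lambda>i. axis i 1) ` UNIV"
    by (auto simp: Basis_vec_def)
  have inj: "inj (\<lambda>i::'q. axis i (1::real))"
    by (auto intro!: injI simp: axis_eq_axis)
  have "(\<integral>\<^sup>+z. (\<Prod>b\<in>Basis. f (z \<bullet> b)) \<partial>(lborel :: (real^'q) measure)) = (\<Prod>b\<in>(Basis :: (real^'q) set). \<integral>\<^sup>+x. f x \<partial>lborel)"
    using assms by (intro nn_integral_lborel_prod) auto
  also have "(\<lambda>z::real^'q. \<Prod>b\<in>Basis. f (z \<bullet> b)) = (\<lambda>z. \<Prod>i\<in>UNIV. f (z $ i))"
    unfolding B by (simp add: prod.reindex[OF inj] inner_axis)
  finally show ?thesis by simp
qed

lemma borel_measurable_gaussian_density [measurable]: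
  "(\<lambda>z::real^'q. \<Prod>i\<in>UNIV. std_normal_density (z $ i)) \<in> borel_measurable borel"
  by (auto simp: normal_density_def intro!: borel_measurable_continuous_onI continuous_intros)

lemma prob_space_std_gaussian: "prob_space (std_gaussian :: (real^'q) measure)"
proof
  have "emeasure (std_gaussian :: (real^'q) measure) UNIV = (\<integral>\<^sup>+z. (\<Prod>i\<in>UNIV. ennreal (std_normal_density (z $ i))) \<partial>(lborel :: (real^'q) measure))"
    unfolding std_gaussian_def by (subst emeasure_density) (auto simp: prod_ennreal)
  also have "\<dots> = (\<integral>\<^sup>+x. ennreal (std_normal_density x) \<partial>lborel) ^ CARD('q)"
    by (rule nn_integral_lborel_vec_prod) measurable
  also have "\<dots> = 1"
    by (subst nn_integral_eq_integral) auto
  finally show "emeasure (std_gaussian :: (real^'q) measure) (space std_gaussian) = 1" by simp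
qed

text \<open>Completing the square: an exponential tilt of the normal density is a multiple of a
  shifted one.\<close>

lemma std_normal_density_mult_exp:
  "std_normal_density x * exp (c * x) = exp (c\<^sup>2 / 2) * normal_density c 1 x"
  by (simp add: normal_density_def exp_add[symmetric] field_simps power2_eq_square)

text \<open>The Euclidean norm is at most the sum of the absolute coordinates, so the exponential is
  dominated by a product and the integral by a power of a one-dimensional one.\<close>

lemma integrable_exp_norm_std_gaussian:
  "integrable (std_gaussian :: (real^'q) measure) (\<lambda>z. exp (c * norm z))"
proof (rule integrableI_bounded)
  let ?\<rho> = "\<lambda>z::real^'q. \<Prod>i\<in>UNIV. std_normal_density (z $ i)"
  let ?e = "\<lambda>x. std_normal_density x * exp (\<bar>c\<bar> * \<bar>x\<bar>)"
  have 1: "exp (c * norm z) \<le> (\<Prod>i\<in>UNIV. exp (\<bar>c\<bar> * \<bar>z $ i\<bar>))" for z :: "real^'q"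
  proof -
    have "c * norm z \<le> \<bar>c\<bar> * (\<Sum>i\<in>UNIV. \<bar>z $ i\<bar>)"
      by (intro mult_mono norm_le_l1_cart) auto
    then show ?thesis by (simp add: exp_sum[symmetric] sum_distrib_left)
  qed
  have "(\<integral>\<^sup>+z. ennreal (norm (exp (c * norm z))) \<partial>(std_gaussian :: (real^'q) measure))
      = (\<integral>\<^sup>+z. ennreal (?\<rho> z) * ennreal (exp (c * norm z)) \<partial>lborel)"
    unfolding std_gaussian_def by (subst nn_integral_density) auto
  also have "\<dots> \<le> (\<integral>\<^sup>+z. (\<Prod>i\<in>UNIV. ennreal (?e (z $ i))) \<partial>(lborel :: (real^'q) measure))"
    by (intro nn_integral_mono)
       (auto simp: prod_ennreal prod.distrib prod_nonneg ennreal_mult[symmetric] intro!: ennreal_leI mult_left_mono 1)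
  also have "\<dots> = (\<integral>\<^sup>+x. ennreal (?e x) \<partial>lborel) ^ CARD('q)"
    by (rule nn_integral_lborel_vec_prod) measurable
  also have "\<dots> < \<infinity>"
  proof -
    \<comment> \<open>One tilted density handles \<open>x \<ge> 0\<close>, the other
      \<open>x < 0\<close>.\<close>
    have le: "?e x \<le> exp (c\<^sup>2 / 2) * normal_density \<bar>c\<bar> 1 x + exp (c\<^sup>2 / 2) * normal_density (- \<bar>c\<bar>) 1 x" for x
      using std_normal_density_mult_exp[of x "\<bar>c\<bar>"] std_normal_density_mult_exp[of x "- \<bar>c\<bar>"]
        normal_density_nonneg[of "\<bar>c\<bar>" 1 x] normal_density_nonneg[of "-\<bar>c\<bar>" 1 x]
      by (cases "x \<ge> 0") (auto simp: abs_if split: if_splits)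
    have maj: "integrable lborel (\<lambda>x. exp (c\<^sup>2 / 2) * normal_density \<bar>c\<bar> 1 x + exp (c\<^sup>2 / 2) * normal_density (- \<bar>c\<bar>) 1 x)"
      by auto
    have "integrable lborel ?e"
    proof (rule Bochner_Integration.integrable_bound[OF maj])
      show "AE x in lborel. norm (?e x) \<le> norm (exp (c\<^sup>2 / 2) * normal_density \<bar>c\<bar> 1 x + exp (c\<^sup>2 / 2) * normal_density (- \<bar>c\<bar>) 1 x)"
        by (intro AE_I2) (use le in \<open>simp only: real_norm_def abs_of_nonneg mult_nonneg_nonneg
          normal_density_nonneg exp_ge_zero add_nonneg_nonneg\<close>)
    qed measurable
    then have "(\<integral>\<^sup>+x. ennreal (?e x) \<partial>lborel) < \<infinity>"
      by (subst nn_integral_eq_integral) auto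
    then show ?thesis by (simp add: power_less_top_ennreal)
  qed
  finally show "(\<integral>\<^sup>+z. ennreal (norm (exp (c * norm z))) \<partial>(std_gaussian :: (real^'q) measure)) < \<infinity>" .
qed measurable

text \<open>A class of Gaussian-integrable growth that is closed under sums and products and
  contains exponential tilts, so that integrability of a majorant can be read off from its
  form.\<close>

definition exp_bounded :: "('a::real_normed_vector \<Rightarrow> real) \<Rightarrow> bool" where
  "exp_bounded F \<longleftrightarrow> (\<exists>K c. \<forall>z. \<bar>F z\<bar> \<le> K * exp (c * norm z))"

lemma exp_boundedE:
  assumes "exp_bounded F"
  obtains K c where "K \<ge> 0" "c \<ge> 0" "\<And>z. \<bar>F z\<bar> \<le> K * exp (c * norm z)"
proof -
  obtain K c where *: "\<And>z. \<bar>F z\<bar> \<le> K * exp (c * norm z)"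
    using assms unfolding exp_bounded_def by blast
  have "\<bar>F z\<bar> \<le> \<bar>K\<bar> * exp (\<bar>c\<bar> * norm z)" for z
    by (rule order_trans[OF *]) (auto intro!: mult_mono mult_right_mono)
  then show ?thesis by (intro that[of "\<bar>K\<bar>" "\<bar>c\<bar>"]) auto
qed

lemma exp_bounded_mono:
  assumes "exp_bounded G" "\<And>z. \<bar>F z\<bar> \<le> G z"
  shows "exp_bounded F"
  using assms unfolding exp_bounded_def by (meson abs_ge_self order_trans)

lemma exp_bounded_const: "exp_bounded (\<lambda>z. c)"
  unfolding exp_bounded_def by (intro exI[of _ "\<bar>c\<bar>"] exI[of _ 0]) auto

lemma exp_bounded_norm: "exp_bounded norm"
  unfolding exp_bounded_def
proof (intro exI[of _ 1] allI)
  fix z :: 'a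
  show "\<bar>norm z\<bar> \<le> 1 * exp (1 * norm z)"
    using exp_ge_add_one_self[of "norm z"] by (simp del: exp_ge_add_one_self)
qed

lemma exp_bounded_exp: "exp_bounded (\<lambda>z. exp (c * norm z))"
  unfolding exp_bounded_def by (intro exI[of _ 1] exI[of _ c]) auto

lemma exp_bounded_add:
  assumes "exp_bounded F" "exp_bounded G"
  shows "exp_bounded (\<lambda>z. F z + G z)"
proof -
  obtain K c where F: "K \<ge> 0" "c \<ge> 0" "\<And>z. \<bar>F z\<bar> \<le> K * exp (c * norm z)" using exp_boundedE[OF assms(1)] by blast
  obtain L d where G: "L \<ge> 0" "d \<ge> 0" "\<And>z. \<bar>G z\<bar> \<le> L * exp (d * norm z)" using exp_boundedE[OF assms(2)] by blast
  have "\<bar>F z + G z\<bar> \<le> (K + L) * exp ((c + d) * norm z)" for z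
  proof -
    have "K * exp (c * norm z) \<le> K * exp ((c + d) * norm z)" "L * exp (d * norm z) \<le> L * exp ((c + d) * norm z)"
      using F G by (auto intro!: mult_left_mono mult_right_mono)
    then show ?thesis using F(3)[of z] G(3)[of z] by (simp add: algebra_simps)
  qed
  then show ?thesis unfolding exp_bounded_def by blast
qed

lemma exp_bounded_mult:
  assumes "exp_bounded F" "exp_bounded G"
  shows "exp_bounded (\<lambda>z. F z * G z)"
proof -
  obtain K c where F: "K \<ge> 0" "c \<ge> 0" "\<And>z. \<bar>F z\<bar> \<le> K * exp (c * norm z)" using exp_boundedE[OF assms(1)] by blast
  obtain L d where G: "L \<ge> 0" "d \<ge> 0" "\<And>z. \<bar>G z\<bar> \<le> L * exp (d * norm z)" using exp_boundedE[OF assms(2)] by blast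
  have "\<bar>F z * G z\<bar> \<le> (K * L) * exp ((c + d) * norm z)" for z
    using mult_mono[OF F(3)[of z] G(3)[of z]] F(1) by (simp add: abs_mult exp_add algebra_simps)
  then show ?thesis unfolding exp_bounded_def by blast
qed

lemmas exp_bounded_intros = exp_bounded_const exp_bounded_norm exp_bounded_exp exp_bounded_add exp_bounded_mult

lemma integrable_std_gaussian_exp_bounded:
  fixes F :: "real^'q \<Rightarrow> real"
  assumes "exp_bounded F" "F \<in> borel_measurable borel"
  shows "integrable std_gaussian F"
proof -
  obtain K c where F: "K \<ge> 0" "c \<ge> 0" "\<And>z. \<bar>F z\<bar> \<le> K * exp (c * norm z)" using exp_boundedE[OF assms(1)] by blast
  show ?thesis
    by (rule Bochner_Integration.integrable_bound[OF integrable_mult_right[OF integrable_exp_norm_std_gaussian[of c], of K]])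
       (use F assms in auto)
qed

section \<open>Translation of the Gaussian law and integration by parts\<close>

lemma gaussian_density_shift:
  fixes z a :: "real^'q"
  shows "(\<Prod>i\<in>UNIV. std_normal_density ((z - a) $ i)) =
    (\<Prod>i\<in>UNIV. std_normal_density (z $ i)) * exp (a \<bullet> z - (norm a)\<^sup>2 / 2)"
proof -
  have "std_normal_density (z $ i - a $ i) = std_normal_density (z $ i) * exp (a $ i * z $ i - (a $ i)\<^sup>2 / 2)" for i
    by (simp add: normal_density_def exp_add[symmetric] field_simps power2_eq_square)
  then have "(\<Prod>i\<in>UNIV. std_normal_density ((z - a) $ i)) =
    (\<Prod>i\<in>UNIV. std_normal_density (z $ i)) * exp (\<Sum>i\<in>UNIV. a $ i * z $ i - (a $ i)\<^sup>2 / 2)"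
    by (simp add: prod.distrib exp_sum)
  also have "(\<Sum>i\<in>UNIV. a $ i * z $ i - (a $ i)\<^sup>2 / 2) = a \<bullet> z - (norm a)\<^sup>2 / 2"
    by (simp add: power2_norm_eq_inner inner_vec_def sum_subtractf sum_divide_distrib[symmetric] power2_eq_square[of "a $ _"])
  finally show ?thesis .
qed

text \<open>The finite-dimensional Cameron-Martin formula: translation invariance of
  \<open>lborel\<close> moves the shift from the integrand to the density, where it becomes an
  exponential factor.\<close>

lemma integral_std_gaussian_shift:
  fixes \<phi> :: "real^'q \<Rightarrow> real"
  assumes [measurable]: "\<phi> \<in> borel_measurable borel"
  shows "(\<integral>z. \<phi> (z + a) \<partial>std_gaussian) = (\<integral>z. \<phi> z * exp (a \<bullet> z - (norm a)\<^sup>2 / 2) \<partial>std_gaussian)"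
proof -
  let ?\<rho> = "\<lambda>z::real^'q. \<Prod>i\<in>UNIV. std_normal_density (z $ i)"
  have "(\<integral>z. \<phi> (z + a) \<partial>std_gaussian) = (\<integral>z. ?\<rho> z * \<phi> (z + a) \<partial>lborel)"
    unfolding std_gaussian_def by (subst integral_density) (auto simp: prod_nonneg)
  also have "\<dots> = (\<integral>z. ?\<rho> (a + z - a) * \<phi> (a + z) \<partial>lborel)"
    by (simp add: add.commute)
  also have "\<dots> = (\<integral>z. ?\<rho> (z - a) * \<phi> z \<partial>distr lborel borel ((+) a))"
    by (subst integral_distr) (auto simp del: vector_minus_component)
  also have "\<dots> = (\<integral>z. ?\<rho> (z - a) * \<phi> z \<partial>lborel)"
    by (simp add: lborel_distr_plus)
  also have "\<dots> = (\<integral>z. ?\<rho> z * (\<phi> z * exp (a \<bullet> z - (norm a)\<^sup>2 / 2)) \<partial>lborel)"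
    unfolding gaussian_density_shift by (simp add: mult_ac)
  also have "\<dots> = (\<integral>z. \<phi> z * exp (a \<bullet> z - (norm a)\<^sup>2 / 2) \<partial>std_gaussian)"
    unfolding std_gaussian_def by (subst integral_density) (auto simp: prod_nonneg)
  finally show ?thesis .
qed

text \<open>Used to dominate the increments at \<open>t = 0\<close> of the Cameron-Martin
  factor.\<close>

lemma abs_exp_minus_one_le: "\<bar>exp y - 1\<bar> \<le> \<bar>y\<bar> * exp \<bar>y\<bar>" for y :: real
proof (cases "y \<ge> 0")
  case True
  have "(1 - y) * exp y \<le> exp (- y) * exp y"
    using exp_ge_add_one_self[of "- y"] by (intro mult_right_mono) (auto simp del: exp_ge_add_one_self)
  with True show ?thesis by (simp add: algebra_simps exp_minus)
next
  case False
  then have "\<bar>exp y - 1\<bar> \<le> \<bar>y\<bar> * 1"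
    using exp_ge_add_one_self[of y] by (simp del: exp_ge_add_one_self)
  also have "\<dots> \<le> \<bar>y\<bar> * exp \<bar>y\<bar>" by (intro mult_left_mono) auto
  finally show ?thesis .
qed

text \<open>Both sides are the derivative at \<open>t = 0\<close> of \<open>E \<phi> (Z + t a)\<close>, once under the integral and
  once after moving the shift onto the density.\<close>

lemma
  fixes \<phi> :: "real^'q \<Rightarrow> real"
  assumes deriv: "\<And>z. (\<phi> has_derivative \<phi>' z) (at z)"
    and lip: "\<And>x y. \<bar>\<phi> x - \<phi> y\<bar> \<le> \<Lambda> * norm (x - y)"
  shows integrable_stein: "integrable std_gaussian (\<lambda>z. \<phi>' z a)"
    and stein_identity: "(\<integral>z. \<phi>' z a \<partial>std_gaussian) = (\<integral>z. \<phi> z * (a \<bullet> z) \<partial>std_gaussian)"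
proof -
  interpret prob_space "std_gaussian :: (real^'q) measure" by (rule prob_space_std_gaussian)
  have "continuous_on UNIV \<phi>"
    using deriv has_derivative_continuous by (blast intro: continuous_at_imp_continuous_on)
  then have meas [measurable]: "\<phi> \<in> borel_measurable borel"
    by (rule borel_measurable_continuous_onI)
  have eb: "exp_bounded \<phi>"
    by (rule exp_bounded_mono[of "\<lambda>z. \<bar>\<phi> 0\<bar> + \<Lambda> * norm z"], intro exp_bounded_intros)
       (use lip[of _ 0] in \<open>smt (verit) diff_zero\<close>)
  have eb_shift: "exp_bounded (\<lambda>z. \<phi> (z + t *\<^sub>R a))" for t
    by (rule exp_bounded_mono[of "\<lambda>z. \<bar>\<phi> (t *\<^sub>R a)\<bar> + \<Lambda> * norm z"], intro exp_bounded_intros)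
       (use lip[of "_ + t *\<^sub>R a" "t *\<^sub>R a"] in \<open>smt (verit) add_diff_cancel_right'\<close>)
  have eb_tilt: "exp_bounded (\<lambda>z. \<phi> z * exp (t * (a \<bullet> z) - t\<^sup>2 * (norm a)\<^sup>2 / 2))" for t
  proof (rule exp_bounded_mult[OF eb], rule exp_bounded_mono[OF exp_bounded_exp[of "\<bar>t\<bar> * norm a"]])
    fix z :: "real^'q"
    have "t * (a \<bullet> z) \<le> \<bar>t\<bar> * (norm a * norm z)"
      using mult_left_mono[OF Cauchy_Schwarz_ineq2[of a z], of "\<bar>t\<bar>"] abs_ge_self[of "t * (a \<bullet> z)"]
      unfolding abs_mult by linarith
    then show "\<bar>exp (t * (a \<bullet> z) - t\<^sup>2 * (norm a)\<^sup>2 / 2)\<bar> \<le> exp (\<bar>t\<bar> * norm a * norm z)"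
      using zero_le_power2[of "t * norm a"]
      by (simp only: abs_exp_cancel exp_le_cancel_iff mult.assoc power_mult_distrib)
  qed
  let ?F = "\<lambda>(t::real) z. \<phi> (z + t *\<^sub>R a)" and ?G = "\<lambda>(t::real) z. \<phi> z * exp (t * (a \<bullet> z) - t\<^sup>2 * (norm a)\<^sup>2 / 2)"
  have lin: "linear (\<phi>' z)" for z using deriv by (rule has_derivative_linear)
  have dF: "((\<lambda>t. ?F t z) has_derivative (\<lambda>u. u * \<phi>' z a)) (at 0)" for z
  proof -
    have "((\<lambda>t. ?F t z) has_derivative (\<lambda>u. \<phi>' z (u *\<^sub>R a))) (at 0)"
      by (rule has_derivative_compose[of "\<lambda>t. z + t *\<^sub>R a" "\<lambda>t. t *\<^sub>R a" 0 UNIV \<phi>, simplified])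
         (auto intro!: derivative_eq_intros deriv)
    then show ?thesis by (simp add: linear_cmul[OF lin])
  qed
  have dG: "((\<lambda>t. ?G t z) has_derivative (\<lambda>u. u * (\<phi> z * (a \<bullet> z)))) (at 0)" for z
    by (auto intro!: derivative_eq_intros)
  have F: "integrable std_gaussian (?F t)" for t
    by (rule integrable_std_gaussian_exp_bounded[OF eb_shift]) measurable
  have G: "integrable std_gaussian (?G t)" for t
    by (rule integrable_std_gaussian_exp_bounded[OF eb_tilt]) measurable
  have lipF: "eventually (\<lambda>t. \<forall>z. \<bar>?F t z - ?F 0 z\<bar> \<le> \<Lambda> * norm a * norm (t - 0)) (at 0)"
    using lip[of "z + t *\<^sub>R a" z for z t] by (intro always_eventually allI) (simp add: mult_ac)
  let ?c = "\<lambda>z. norm a * norm z + (norm a)\<^sup>2 / 2"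
  \<comment> \<open>For \<open>\<bar>t\<bar> < 1\<close> also
    \<open>t\<^sup>2 \<le> \<bar>t\<bar>\<close>, so the exponent \<open>y\<close> of the tilt
    satisfies \<open>\<bar>y\<bar> \<le> \<bar>t\<bar> * ?c z\<close>. The factor
    \<open>exp (?c z)\<close> is split into a product to match the closure rules of
    \<open>exp_bounded\<close>.\<close>
  have lipG: "eventually (\<lambda>t. \<forall>z. \<bar>?G t z - ?G 0 z\<bar> \<le> \<bar>\<phi> z\<bar> * (?c z * (exp (norm a * norm z) * exp ((norm a)\<^sup>2 / 2))) * norm (t - 0)) (at 0)"
    unfolding eventually_at
  proof (intro exI[of _ 1] conjI ballI impI allI)
    fix t :: real and z :: "real^'q" assume t: "t \<noteq> 0 \<and> dist t 0 < 1"
    define y where "y = t * (a \<bullet> z) - t\<^sup>2 * (norm a)\<^sup>2 / 2"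
    have incr: "?G t z - ?G 0 z = \<phi> z * (exp y - 1)"
      by (simp add: y_def right_diff_distrib)
    have t1: "\<bar>t\<bar> \<le> 1" using t by simp
    have "t\<^sup>2 \<le> \<bar>t\<bar>"
      using mult_right_mono[OF t1, of "\<bar>t\<bar>"] by (simp add: power2_eq_square)
    then have "t\<^sup>2 * (norm a)\<^sup>2 / 2 \<le> \<bar>t\<bar> * (norm a)\<^sup>2 / 2"
      by (intro divide_right_mono mult_right_mono) auto
    moreover have "\<bar>t * (a \<bullet> z)\<bar> \<le> \<bar>t\<bar> * (norm a * norm z)"
      unfolding abs_mult by (intro mult_left_mono Cauchy_Schwarz_ineq2) auto
    moreover have "0 \<le> t\<^sup>2 * (norm a)\<^sup>2 / 2" by simp
    ultimately have y: "\<bar>y\<bar> \<le> \<bar>t\<bar> * ?c z"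
      unfolding y_def distrib_left times_divide_eq_right by linarith
    have c0: "?c z \<ge> 0" by simp
    have "\<bar>y\<bar> \<le> ?c z" using y mult_right_mono[OF t1 c0] by simp
    have "\<bar>exp y - 1\<bar> \<le> \<bar>y\<bar> * exp \<bar>y\<bar>" by (rule abs_exp_minus_one_le)
    also have "\<dots> \<le> (\<bar>t\<bar> * ?c z) * exp (?c z)"
      using y \<open>\<bar>y\<bar> \<le> ?c z\<close> c0 by (intro mult_mono) auto
    finally have "\<bar>\<phi> z\<bar> * \<bar>exp y - 1\<bar> \<le> \<bar>\<phi> z\<bar> * ((\<bar>t\<bar> * ?c z) * exp (?c z))"
      by (intro mult_left_mono) auto
    then show "\<bar>?G t z - ?G 0 z\<bar> \<le> \<bar>\<phi> z\<bar> * (?c z * (exp (norm a * norm z) * exp ((norm a)\<^sup>2 / 2))) * norm (t - 0)"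
      unfolding incr abs_mult exp_add by (simp only: mult_ac diff_zero real_norm_def)
  qed auto
  have "exp_bounded (\<lambda>z. \<bar>\<phi> z\<bar>)" using eb by (simp add: exp_bounded_def)
  then have "exp_bounded (\<lambda>z. \<bar>\<phi> z\<bar> * ((norm a * norm z + (norm a)\<^sup>2 / 2) * (exp (norm a * norm z) * exp ((norm a)\<^sup>2 / 2))))"
    by (intro exp_bounded_intros)
  then have KG: "integrable std_gaussian (\<lambda>z. \<bar>\<phi> z\<bar> * (?c z * (exp (norm a * norm z) * exp ((norm a)\<^sup>2 / 2))))"
    by (rule integrable_std_gaussian_exp_bounded) measurable
  have KF: "integrable (std_gaussian :: (real^'q) measure) (\<lambda>z. \<Lambda> * norm a)"
    by simp
  show "integrable std_gaussian (\<lambda>z. \<phi>' z a)"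
    using integrable_derivative_dominated[OF F dF lipF KF, of 1] by simp
  have "(\<integral>z. ?F t z \<partial>std_gaussian) = (\<integral>z. ?G t z \<partial>std_gaussian)" for t
    by (subst integral_std_gaussian_shift[OF meas]) (simp add: power_mult_distrib)
  then have "((\<lambda>t. \<integral>z. ?F t z \<partial>std_gaussian) has_derivative (\<lambda>u. \<integral>z. u * (\<phi> z * (a \<bullet> z)) \<partial>std_gaussian)) (at 0)"
    using has_derivative_integral_dominated[OF G dG lipG KG] by simp
  from fun_cong[OF has_derivative_unique[OF has_derivative_integral_dominated[OF F dF lipF KF] this], of 1]
  show "(\<integral>z. \<phi>' z a \<partial>std_gaussian) = (\<integral>z. \<phi> z * (a \<bullet> z) \<partial>std_gaussian)"
    by simp
qed

section \<open>First and second Gaussian moments, from Stein's identity for constant and linear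
  functions\<close>

lemma integral_std_gaussian_inner:
  fixes a :: "real^'q"
  shows "(\<integral>z. a \<bullet> z \<partial>std_gaussian) = 0"
proof -
  have "(\<integral>z. 0 \<partial>(std_gaussian :: (real^'q) measure)) = (\<integral>z. 1 * (a \<bullet> z) \<partial>std_gaussian)"
    by (rule stein_identity[of "\<lambda>_. 1" "\<lambda>_ _. 0" 0 a]) auto
  then show ?thesis by simp
qed

lemma integral_std_gaussian_inner_mult:
  fixes a b :: "real^'q"
  shows "(\<integral>z. (b \<bullet> z) * (a \<bullet> z) \<partial>std_gaussian) = b \<bullet> a"
proof -
  interpret prob_space "std_gaussian :: (real^'q) measure" by (rule prob_space_std_gaussian)
  have "\<bar>b \<bullet> x - b \<bullet> y\<bar> \<le> norm b * norm (x - y)" for x y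
    using Cauchy_Schwarz_ineq2[of b "x - y"] by (simp add: inner_diff_right)
  then have "(\<integral>z. b \<bullet> a \<partial>(std_gaussian :: (real^'q) measure)) = (\<integral>z. (b \<bullet> z) * (a \<bullet> z) \<partial>std_gaussian)"
    by (intro stein_identity[of "\<lambda>z. b \<bullet> z" "\<lambda>_ u. b \<bullet> u"])
       (auto intro!: derivative_eq_intros)
  then show ?thesis
    using prob_space by simp
qed

text \<open>Expanding row by row, the term linear in \<open>z\<close> is centred and drops out. The
  remaining sum is the squared Frobenius norm of \<open>\<beta>\<close>, that is, the trace of the
  covariance.\<close>

lemma
  fixes \<alpha> :: "real^'d" and \<beta> :: "real^'q^'d"
  shows integrable_norm_affine_square:
      "integrable std_gaussian (\<lambda>z. (norm (\<alpha> + \<beta> *v z))\<^sup>2)"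
    and integral_norm_affine_square:
      "(\<integral>z. (norm (\<alpha> + \<beta> *v z))\<^sup>2 \<partial>std_gaussian) = (norm \<alpha>)\<^sup>2 + (\<Sum>k\<in>UNIV. (norm (\<beta> $ k))\<^sup>2)"
proof -
  interpret prob_space "std_gaussian :: (real^'q) measure" by (rule prob_space_std_gaussian)
  have row: "(\<beta> *v z) $ k = \<beta> $ k \<bullet> z" for z k
    by (simp add: matrix_vector_mult_def inner_vec_def)
  have eq: "(norm (\<alpha> + \<beta> *v z))\<^sup>2 = (\<Sum>k\<in>UNIV. (\<alpha> $ k)\<^sup>2 + 2 * \<alpha> $ k * (\<beta> $ k \<bullet> z) + (\<beta> $ k \<bullet> z) * (\<beta> $ k \<bullet> z))" for z
    unfolding power2_norm_eq_inner inner_vec_def[of "\<alpha> + \<beta> *v z"]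
    by (intro sum.cong) (auto simp: row power2_eq_square algebra_simps)
  have i: "exp_bounded (\<lambda>z. v \<bullet> z)" for v :: "real^'q"
    by (rule exp_bounded_mono[of "\<lambda>z. norm v * norm z"]) (auto intro!: exp_bounded_intros Cauchy_Schwarz_ineq2)
  have i1: "integrable std_gaussian (\<lambda>z. v \<bullet> z)" for v :: "real^'q"
    by (rule integrable_std_gaussian_exp_bounded[OF i]) measurable
  have i2: "integrable std_gaussian (\<lambda>z. (v \<bullet> z) * (v \<bullet> z))" for v :: "real^'q"
    by (rule integrable_std_gaussian_exp_bounded[OF exp_bounded_mult[OF i i]]) measurable
  show "integrable std_gaussian (\<lambda>z. (norm (\<alpha> + \<beta> *v z))\<^sup>2)"
    unfolding eq by (intro Bochner_Integration.integrable_sum Bochner_Integration.integrable_add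
        integrable_mult_right i1 i2) simp
  have "(\<integral>z. (\<alpha> $ k)\<^sup>2 + 2 * \<alpha> $ k * (\<beta> $ k \<bullet> z) + (\<beta> $ k \<bullet> z) * (\<beta> $ k \<bullet> z) \<partial>std_gaussian)
      = (\<alpha> $ k)\<^sup>2 + \<beta> $ k \<bullet> \<beta> $ k" for k
    using prob_space i1[of "\<beta> $ k"] i2[of "\<beta> $ k"]
    by (simp add: integral_std_gaussian_inner integral_std_gaussian_inner_mult)
  then show "(\<integral>z. (norm (\<alpha> + \<beta> *v z))\<^sup>2 \<partial>std_gaussian) = (norm \<alpha>)\<^sup>2 + (\<Sum>k\<in>UNIV. (norm (\<beta> $ k))\<^sup>2)"
    unfolding eq
    by (subst Bochner_Integration.integral_sum)
       (simp_all add: i1 i2 sum.distrib norm_eq_sqrt_inner inner_vec_def[of \<alpha>] power2_eq_square[of "\<alpha> $ _"] sum_nonneg)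
qed

section \<open>Gradients and Lipschitz constants\<close>

lemma has_derivative_fderiv:
  assumes "g differentiable (at x)"
  shows "(g has_derivative blinfun_apply (fderiv g x)) (at x)"
proof -
  have "(g has_derivative frechet_derivative g (at x)) (at x)"
    using assms by (simp add: frechet_derivative_works)
  then show ?thesis
    unfolding fderiv_def by (simp add: bounded_linear_Blinfun_apply has_derivative_bounded_linear)
qed

lemma grad_eq: "GDERIV f x :> D \<Longrightarrow> grad f x = D"
proof -
  assume D: "GDERIV f x :> D"
  have "D' = D" if "GDERIV f x :> D'" for D'
  proof -
    have "(\<lambda>h. h \<bullet> D') = (\<lambda>h. h \<bullet> D)"
      using that D unfolding gderiv_def by (rule has_derivative_unique)
    then have "\<forall>h. h \<bullet> D' = h \<bullet> D" by metis
    then show ?thesis using vector_eq_ldot by blast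
  qed
  with D show ?thesis unfolding grad_def by blast
qed

text \<open>Riesz representation in the orthonormal \<open>Basis\<close>.\<close>

lemma GDERIV_of_has_derivative:
  fixes f :: "'a::euclidean_space \<Rightarrow> real"
  assumes "(f has_derivative f') (at x)"
  shows "GDERIV f x :> (\<Sum>b\<in>Basis. f' b *\<^sub>R b)"
proof -
  have lin: "linear f'" using assms by (rule has_derivative_linear)
  have "f' u = u \<bullet> (\<Sum>b\<in>Basis. f' b *\<^sub>R b)" for u
  proof -
    have "f' u = f' (\<Sum>b\<in>Basis. (u \<bullet> b) *\<^sub>R b)" by (simp add: euclidean_representation)
    also have "\<dots> = (\<Sum>b\<in>Basis. (u \<bullet> b) * f' b)"
      by (simp add: linear_sum[OF lin] linear_cmul[OF lin])
    finally show ?thesis by (simp add: inner_sum_right mult.commute)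
  qed
  then have "f' = (\<lambda>u. u \<bullet> (\<Sum>b\<in>Basis. f' b *\<^sub>R b))" by (rule ext)
  with assms show ?thesis unfolding gderiv_def by (rule back_subst)
qed

lemma norm_derivative_le_lipschitz:
  assumes lip: "K-lipschitz_on UNIV f" and deriv: "(f has_derivative f') (at x)"
  shows "norm (f' u) \<le> K * norm u"
proof -
  have lin: "linear f'" using deriv by (rule has_derivative_linear)
  have "((\<lambda>t. f (x + t *\<^sub>R u)) has_derivative (\<lambda>t. f' (t *\<^sub>R u))) (at (0::real))"
    by (rule has_derivative_compose[of "\<lambda>t. x + t *\<^sub>R u" "\<lambda>t. t *\<^sub>R u" 0 UNIV f, simplified])
       (auto intro!: derivative_eq_intros deriv)
  then have "((\<lambda>t. norm (f (x + t *\<^sub>R u) - f x - t *\<^sub>R f' u) / norm t) \<longlongrightarrow> 0) (at (0::real))"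
    by (simp add: has_derivative_iff_norm linear_cmul[OF lin])
  from tendsto_add[OF tendsto_const[of "K * norm u"] this]
  have "((\<lambda>t. K * norm u + norm (f (x + t *\<^sub>R u) - f x - t *\<^sub>R f' u) / norm t) \<longlongrightarrow> K * norm u) (at (0::real))"
    by simp
  then show ?thesis
  proof (rule tendsto_lowerbound)
    show "eventually (\<lambda>t. norm (f' u) \<le> K * norm u + norm (f (x + t *\<^sub>R u) - f x - t *\<^sub>R f' u) / norm t) (at (0::real))"
      unfolding eventually_at
    proof (intro exI[of _ 1] conjI ballI impI)
      fix t :: real assume t: "t \<noteq> 0 \<and> dist t 0 < 1"
      have "norm (t *\<^sub>R f' u) \<le> norm (f (x + t *\<^sub>R u) - f x) + norm (f (x + t *\<^sub>R u) - f x - t *\<^sub>R f' u)"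
        using norm_triangle_ineq4[of "f (x + t *\<^sub>R u) - f x" "f (x + t *\<^sub>R u) - f x - t *\<^sub>R f' u"] by simp
      also have "norm (f (x + t *\<^sub>R u) - f x) \<le> K * norm (t *\<^sub>R u)"
        using lipschitz_on_normD[OF lip, of "x + t *\<^sub>R u" x] by simp
      finally show "norm (f' u) \<le> K * norm u + norm (f (x + t *\<^sub>R u) - f x - t *\<^sub>R f' u) / norm t"
        using t by (simp add: field_simps)
    qed simp
  qed simp
qed

lemma lipschitz_on_UNIV_of_derivative_bound:
  fixes f :: "'a::real_normed_vector \<Rightarrow> 'b::real_normed_vector"
  assumes "K \<ge> 0" "\<And>x. (f has_derivative f' x) (at x)" "\<And>x u. norm (f' x u) \<le> K * norm u"
  shows "K-lipschitz_on UNIV f"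
proof (rule lipschitz_onI)
  fix x y
  have "norm (f x - f y) \<le> K * norm (x - y)"
    by (rule differentiable_bound[of UNIV f f']) (use assms in \<open>auto intro: onorm_bound\<close>)
  then show "dist (f x) (f y) \<le> K * dist x y" by (simp add: dist_norm)
qed fact

text \<open>The passage between extended-valued constants and ordinary Lipschitz bounds. The
  diagonal, left out of \<open>lip_const\<close>, imposes no condition.\<close>

lemma lip_const_le_iff:
  assumes "K \<ge> 0"
  shows "lip_const g \<le> ennreal K \<longleftrightarrow> K-lipschitz_on UNIV g"
proof -
  have "lip_const g \<le> ennreal K \<longleftrightarrow> (\<forall>x y. x \<noteq> y \<longrightarrow> dist (g x) (g y) / dist x y \<le> K)"
    using assms by (auto simp: lip_const_def SUP_le_iff) metis+
  also have "\<dots> \<longleftrightarrow> (\<forall>x y. dist (g x) (g y) \<le> K * dist x y)"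
  proof (intro iff_allI)
    fix x y
    show "(x \<noteq> y \<longrightarrow> dist (g x) (g y) / dist x y \<le> K) \<longleftrightarrow> dist (g x) (g y) \<le> K * dist x y"
      by (cases "x = y") (auto simp: pos_divide_le_eq)
  qed
  finally show ?thesis using assms by (auto simp: lipschitz_on_def)
qed

lemma sup_norm_le_iff:
  assumes "K \<ge> 0"
  shows "sup_norm g \<le> ennreal K \<longleftrightarrow> (\<forall>x. norm (g x) \<le> K)"
  using assms by (simp add: sup_norm_def SUP_le_iff)

lemma ennreal_le_realI:
  fixes a b :: ennreal
  assumes "\<And>K. K \<ge> 0 \<Longrightarrow> b = ennreal K \<Longrightarrow> a \<le> ennreal K"
  shows "a \<le> b"
  using assms by (cases b) auto

text \<open>One direction tests the derivative on the gradient itself, the other is the mean value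
  inequality. It turns the bound on \<open>[P f]\<close> into a bound on the sup norm of a
  gradient.\<close>

lemma sup_norm_gradient_eq_lip_const:
  fixes f :: "'a::real_inner \<Rightarrow> real"
  assumes "\<And>x. GDERIV f x :> g x"
  shows "sup_norm g = lip_const f"
proof (rule antisym)
  have d: "(f has_derivative (\<lambda>u. u \<bullet> g x)) (at x)" for x
    using assms by (simp add: gderiv_def)
  show "sup_norm g \<le> lip_const f"
  proof (rule ennreal_le_realI)
    fix K :: real assume K: "K \<ge> 0" "lip_const f = ennreal K"
    then have lip: "K-lipschitz_on UNIV f" using lip_const_le_iff[of K f] by simp
    have "norm (g x) \<le> K" for x
    proof (cases "g x = 0")
      case False
      have "norm (g x) * norm (g x) \<le> K * norm (g x)"
        using norm_derivative_le_lipschitz[OF lip d[of x], of "g x"]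
        by (simp add: power2_norm_eq_inner[symmetric] power2_eq_square)
      with False show ?thesis by simp
    qed (use K in simp)
    then show "sup_norm g \<le> ennreal K" using K by (simp add: sup_norm_le_iff)
  qed
  show "lip_const f \<le> sup_norm g"
  proof (rule ennreal_le_realI)
    fix K :: real assume K: "K \<ge> 0" "sup_norm g = ennreal K"
    then have *: "norm (g x) \<le> K" for x using sup_norm_le_iff[of K g] by simp
    have "norm (u \<bullet> g x) \<le> K * norm u" for u x
      using Cauchy_Schwarz_ineq2[of u "g x"] mult_left_mono[OF *[of x], of "norm u"]
      by (simp add: mult.commute)
    then have "K-lipschitz_on UNIV f"
      by (rule lipschitz_on_UNIV_of_derivative_bound[OF K(1) d])
    then show "lip_const f \<le> ennreal K" using K by (simp add: lip_const_le_iff)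
  qed
qed

section \<open>The matrix-vector product and bounds on its rows\<close>

lemma bounded_bilinear_matrix_vector_mult:
  "bounded_bilinear ((*v) :: real^'q^'d \<Rightarrow> real^'q \<Rightarrow> real^'d)"
proof -
  have "bilinear ((*v) :: real^'q^'d \<Rightarrow> real^'q \<Rightarrow> real^'d)"
    unfolding bilinear_def
    by (auto intro!: linearI simp: matrix_vector_mult_def vec_eq_iff sum.distrib scaleR_sum_right algebra_simps sum_distrib_left)
  then show ?thesis by (simp add: bilinear_conv_bounded_bilinear)
qed

interpretation matrix_vector_mult: bounded_bilinear "(*v) :: real^'q^'d \<Rightarrow> real^'q \<Rightarrow> real^'d"
  by (rule bounded_bilinear_matrix_vector_mult)

lemma matrix_vector_mult_row_nth: "(A *v z) $ k = (A $ k) \<bullet> z" for A :: "real^'q^'d"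
  by (simp add: matrix_vector_mult_def inner_vec_def)

text \<open>Applying \<open>A\<close> to its own row \<open>A $ k\<close> produces the squared norm
  of that row in component \<open>k\<close>.\<close>

lemma norm_row_le: "norm (A $ k) \<le> K" if "\<And>w. norm (A *v w) \<le> K * norm w" "K \<ge> 0" for A :: "real^'m^'n"
proof (cases "A $ k = 0")
  case False
  have "norm (A $ k) * norm (A $ k) = (A *v (A $ k)) $ k"
    by (simp add: matrix_vector_mult_row_nth power2_norm_eq_inner[symmetric] power2_eq_square)
  also have "\<dots> \<le> norm (A *v (A $ k))" using component_le_norm_cart[of "A *v (A $ k)" k] by linarith
  also have "\<dots> \<le> K * norm (A $ k)" by (rule that)
  finally show ?thesis using False by simp
qed (use that in simp)

text \<open>Gradients of \<open>P f\<close> are accessible only through their inner products with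
  fixed vectors; testing with \<open>sgn w\<close> recovers the norm.\<close>

lemma norm_le_of_inner_le:
  fixes w :: "'a::real_inner"
  assumes "K \<ge> 0" "\<And>u. norm u \<le> 1 \<Longrightarrow> u \<bullet> w \<le> K"
  shows "norm w \<le> K"
proof (cases "w = 0")
  case False
  then show ?thesis
    using assms(2)[of "sgn w"] by (simp add: sgn_div_norm dot_square_norm power2_eq_square field_simps)
qed (use assms in simp)

text \<open>Differentiability at one point already controls the increments from that point. For
  \<open>Db\<close> and \<open>D\<sigma>\<close> this is the input to domination under the
  integral.\<close>

lemma has_derivative_locally_lipschitz:
  assumes "(\<phi> has_derivative \<phi>') (at x0)"
  obtains c where "c \<ge> 0" "eventually (\<lambda>x. norm (\<phi> x - \<phi> x0) \<le> c * norm (x - x0)) (at x0)"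
proof -
  obtain B where B: "B \<ge> 0" "\<And>u. norm (\<phi>' u) \<le> norm u * B"
    using bounded_linear.nonneg_bounded[OF has_derivative_bounded_linear[OF assms]] by blast
  have "((\<lambda>x. norm (\<phi> x - \<phi> x0 - \<phi>' (x - x0)) / norm (x - x0)) \<longlongrightarrow> 0) (at x0)"
    using assms by (simp add: has_derivative_iff_norm)
  then have "eventually (\<lambda>x. norm (\<phi> x - \<phi> x0 - \<phi>' (x - x0)) / norm (x - x0) < 1) (at x0)"
    by (rule order_tendstoD) simp
  moreover have "eventually (\<lambda>x. x \<noteq> x0) (at x0)" by (simp add: eventually_neq_at_within)
  ultimately have "eventually (\<lambda>x. norm (\<phi> x - \<phi> x0) \<le> (B + 1) * norm (x - x0)) (at x0)"
  proof eventually_elim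
    case (elim x)
    then have "norm (\<phi> x - \<phi> x0 - \<phi>' (x - x0)) \<le> norm (x - x0)" by (simp add: field_simps)
    then have "norm (\<phi> x - \<phi> x0) \<le> norm (x - x0) + norm (\<phi>' (x - x0))"
      using norm_triangle_sub[of "\<phi> x - \<phi> x0" "\<phi>' (x - x0)"] by linarith
    also have "norm (\<phi>' (x - x0)) \<le> norm (x - x0) * B" by (rule B)
    finally show ?case by (simp add: algebra_simps)
  qed
  then show ?thesis using that[of "B + 1"] B(1) by simp
qed

text \<open>The class on which one step is estimated. The Hessian of \<open>f\<close> appears as the
  derivative of \<open>g\<close>, which \<open>L\<close> bounds in operator norm; no continuity of
  the Hessian is included.\<close>

definition regular_grad :: "('a::real_inner \<Rightarrow> real) \<Rightarrow> ('a \<Rightarrow> 'a) \<Rightarrow> real \<Rightarrow> bool" where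
  "regular_grad f g L \<longleftrightarrow> (\<forall>x. GDERIV f x :> g x) \<and> (\<forall>x. g differentiable (at x)) \<and> L-lipschitz_on UNIV g"

lemma regular_grad_of_twice_differentiable:
  fixes f :: "'a::euclidean_space \<Rightarrow> real"
  assumes "twice_differentiable f" "L-lipschitz_on UNIV (grad f)"
  shows "regular_grad f (grad f) L"
proof -
  have G: "GDERIV f x :> (\<Sum>b\<in>Basis. fderiv f x b *\<^sub>R b)" for x
    using assms unfolding twice_differentiable_def
    by (intro GDERIV_of_has_derivative has_derivative_fderiv) auto
  then have eq: "grad f = (\<lambda>x. \<Sum>b\<in>Basis. fderiv f x b *\<^sub>R b)"
    by (auto intro!: grad_eq)
  have D: "(fderiv f has_derivative fderiv (fderiv f) x) (at x)" for x
    using assms unfolding twice_differentiable_def by (intro has_derivative_fderiv) auto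
  have "(\<lambda>x. \<Sum>b\<in>Basis. fderiv f x b *\<^sub>R b) differentiable (at x)" for x
    unfolding differentiable_def
    by (rule exI) (rule derivative_eq_intros D refl bounded_linear.has_derivative[OF bounded_linear_blinfun_apply] | simp)+
  with G assms(2) show ?thesis unfolding regular_grad_def eq by simp
qed

text \<open>A weaker class that \<open>P\<close> preserves whatever the size of
  \<open>D\<^sup>2b\<close>. It gives integrability and differentiability of every iterate.\<close>

definition linear_growth_grad :: "('a::real_inner \<Rightarrow> real) \<Rightarrow> ('a \<Rightarrow> 'a) \<Rightarrow> bool" where
  "linear_growth_grad f g \<longleftrightarrow> (\<forall>x. GDERIV f x :> g x) \<and> (\<exists>A\<ge>0. \<forall>x. norm (g x) \<le> A * (1 + norm x))"

lemma linear_growth_grad_of_regular: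
  assumes "regular_grad f g L"
  shows "linear_growth_grad f g"
proof -
  have L: "L-lipschitz_on UNIV g" and L0: "L \<ge> 0"
    using assms lipschitz_on_nonneg by (auto simp: regular_grad_def)
  have "norm (g x) \<le> (norm (g 0) + L) * (1 + norm x)" for x
  proof -
    have "norm (g x) \<le> norm (g 0) + L * norm x"
      using lipschitz_on_normD[OF L, of x 0] norm_triangle_sub[of "g x" "g 0"] by simp
    also have "\<dots> \<le> (norm (g 0) + L) * (1 + norm x)"
      using L0 by (simp add: algebra_simps)
    finally show ?thesis .
  qed
  with L0 assms show ?thesis
    unfolding linear_growth_grad_def regular_grad_def
    by (intro conjI exI[of _ "norm (g 0) + L"]) auto
qed

text \<open>Mean value inequality on the segment from \<open>y\<close> to \<open>y'\<close>, whose
  points have norm at most \<open>norm y + norm (y' - y)\<close>.\<close>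

lemma linear_growth_increment:
  assumes G: "\<And>x. GDERIV f x :> g x" and A: "A \<ge> 0" "\<And>x. norm (g x) \<le> A * (1 + norm x)"
  shows "\<bar>f y' - f y\<bar> \<le> A * (1 + norm y + norm (y' - y)) * norm (y' - y)"
proof -
  have "norm (f y' - f y) \<le> A * (1 + norm y + norm (y' - y)) * norm (y' - y)"
  proof (rule differentiable_bound[of "closed_segment y y'" f "\<lambda>w u. u \<bullet> g w"])
    fix w assume w: "w \<in> closed_segment y y'"
    show "(f has_derivative (\<lambda>u. u \<bullet> g w)) (at w within closed_segment y y')"
      using G by (auto simp: gderiv_def intro: has_derivative_at_withinI)
    have "norm (w - y) \<le> norm (y' - y)"
      using w segment_bound(1) by blast
    then have "norm w \<le> norm y + norm (y' - y)"
      using norm_triangle_sub[of w y] by linarith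
    then have *: "norm (g w) \<le> A * (1 + norm y + norm (y' - y))"
      using A by (intro order_trans[OF A(2)] mult_left_mono) auto
    show "onorm (\<lambda>u. u \<bullet> g w) \<le> A * (1 + norm y + norm (y' - y))"
    proof (rule onorm_bound)
      show "0 \<le> A * (1 + norm y + norm (y' - y))" using A by simp
      fix u
      show "norm (u \<bullet> g w) \<le> A * (1 + norm y + norm (y' - y)) * norm u"
        using Cauchy_Schwarz_ineq2[of u "g w"] mult_right_mono[OF *, of "norm u"]
        by (simp add: mult.commute)
    qed
  qed auto
  then show ?thesis by simp
qed

section \<open>The Euler scheme\<close>

text \<open>Chosen so that \<open>1 + h * moment_rate q h Kb Ks\<close> equals
  \<open>(1 + h * Kb)\<^sup>2 + h * q * Ks\<^sup>2\<close>, the bound on the second moment of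
  \<open>DE x Z u\<close> for unit \<open>u\<close> and noise dimension \<open>q\<close>.\<close>

definition moment_rate :: "nat \<Rightarrow> real \<Rightarrow> real \<Rightarrow> real \<Rightarrow> real" where
  "moment_rate q h Kb Ks = 2 * Kb + h * Kb\<^sup>2 + real q * Ks\<^sup>2"

locale euler_scheme =
  fixes h :: real and b :: "real^'d \<Rightarrow> real^'d" and s :: "real^'d \<Rightarrow> real^'q^'d" and Kb Ks K2 :: real
  assumes h_pos: "h > 0"
    and b2: "twice_differentiable b" and s2: "twice_differentiable s"
    and Kb_nonneg: "Kb \<ge> 0" and Ks_nonneg: "Ks \<ge> 0" and K2_nonneg: "K2 \<ge> 0"
    and Kb: "\<And>x u. norm (fderiv b x u) \<le> Kb * norm u"
    and Ks: "\<And>x u z. norm (fderiv s x u *v z) \<le> Ks * norm u * norm z"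
    and K2: "\<And>i j x w. norm ((partial2 i j s x ** transpose (s x)) *v w) \<le> K2 * norm w"
begin

abbreviation "E \<equiv> euler_step h b s"

definition DE :: "real^'d \<Rightarrow> real^'q \<Rightarrow> real^'d \<Rightarrow> real^'d" where
  "DE x z u = u + h *\<^sub>R fderiv b x u + sqrt h *\<^sub>R (fderiv s x u *v z)"

definition D2E :: "real^'d \<Rightarrow> real^'q \<Rightarrow> real^'d \<Rightarrow> real^'d \<Rightarrow> real^'d" where
  "D2E x z u v = h *\<^sub>R D2 b x u v + sqrt h *\<^sub>R (D2 s x u v *v z)"

text \<open>A Lipschitz constant of the Euler step in \<open>x\<close> for frozen noise
  \<open>z\<close>. It is affine in \<open>norm z\<close>, so all its powers are integrable.\<close>

definition lipE :: "real^'q \<Rightarrow> real" where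
  "lipE z = 1 + h * Kb + sqrt h * Ks * norm z"

lemma moment_rate_nonneg: "moment_rate q h Kb Ks \<ge> 0"
  using h_pos Kb_nonneg by (simp add: moment_rate_def)

lemma lipE_nonneg: "lipE z \<ge> 0"
  using h_pos Kb_nonneg Ks_nonneg by (simp add: lipE_def)

lemma exp_bounded_lipE: "exp_bounded lipE"
  unfolding lipE_def by (intro exp_bounded_intros)

lemma has_derivative_b: "(b has_derivative blinfun_apply (fderiv b x)) (at x)"
  and has_derivative_s: "(s has_derivative blinfun_apply (fderiv s x)) (at x)"
  and has_derivative_fderiv_b: "((\<lambda>x. blinfun_apply (fderiv b x) v) has_derivative (\<lambda>u. D2 b x u v)) (at x)"
  and has_derivative_fderiv_s: "((\<lambda>x. blinfun_apply (fderiv s x) v) has_derivative (\<lambda>u. D2 s x u v)) (at x)"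
  using b2 s2 unfolding twice_differentiable_def D2_def
  by (auto intro!: has_derivative_fderiv
      bounded_linear.has_derivative[OF blinfun.bounded_linear_left])

lemma has_derivative_E: "((\<lambda>x. E x z) has_derivative DE x z) (at x)"
  unfolding euler_step_def DE_def
  by (auto intro!: derivative_eq_intros has_derivative_b
      bounded_linear.has_derivative[OF matrix_vector_mult.bounded_linear_left has_derivative_s])

lemma has_derivative_E_noise: "((\<lambda>z. E x z) has_derivative (\<lambda>w. sqrt h *\<^sub>R (s x *v w))) (at z)"
  unfolding euler_step_def
  by (auto intro!: derivative_eq_intros
      bounded_linear.has_derivative[OF matrix_vector_mult.bounded_linear_right])

lemma has_derivative_DE: "((\<lambda>x. DE x z v) has_derivative (\<lambda>u. D2E x z u v)) (at x)"
proof -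
  have 1: "((\<lambda>x. h *\<^sub>R fderiv b x v) has_derivative (\<lambda>u. h *\<^sub>R D2 b x u v)) (at x)"
    by (intro has_derivative_scaleR_right has_derivative_fderiv_b)
  have 2: "((\<lambda>x. sqrt h *\<^sub>R (fderiv s x v *v z)) has_derivative (\<lambda>u. sqrt h *\<^sub>R (D2 s x u v *v z))) (at x)"
    by (intro has_derivative_scaleR_right
        bounded_linear.has_derivative[OF matrix_vector_mult.bounded_linear_left has_derivative_fderiv_s])
  from has_derivative_add[OF has_derivative_add[OF has_derivative_const[of v] 1] 2] show ?thesis
    by (simp add: DE_def D2E_def)
qed

lemma norm_DE_le: "norm (DE x z u) \<le> lipE z * norm u"
proof -
  have "norm (DE x z u) \<le> norm u + h * norm (fderiv b x u) + sqrt h * norm (fderiv s x u *v z)"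
    unfolding DE_def using h_pos
    by (intro order_trans[OF norm_triangle_ineq] add_mono) auto
  also have "\<dots> \<le> norm u + h * (Kb * norm u) + sqrt h * (Ks * norm u * norm z)"
    using h_pos by (intro add_mono mult_left_mono Kb Ks) auto
  also have "\<dots> = lipE z * norm u" by (simp add: lipE_def algebra_simps)
  finally show ?thesis .
qed

lemma norm_E_diff_le: "norm (E x z - E y z) \<le> lipE z * norm (x - y)"
  using lipschitz_on_normD[OF lipschitz_on_UNIV_of_derivative_bound[OF lipE_nonneg has_derivative_E norm_DE_le]]
  by simp

lemma exp_bounded_norm_matrix_vector: "exp_bounded (\<lambda>z. norm (A *v z))" for A :: "real^'q^'d"
  by (rule exp_bounded_mono[of "\<lambda>z. onorm ((*v) A) * norm z"])
     (auto intro!: exp_bounded_intros onorm)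

lemma exp_bounded_norm_affine:
  "exp_bounded (\<lambda>z. norm (\<alpha> + c *\<^sub>R (A *v z)))" for A :: "real^'q^'d"
  by (rule exp_bounded_mono[of "\<lambda>z. norm \<alpha> + \<bar>c\<bar> * norm (A *v z)"])
     (auto intro!: exp_bounded_intros exp_bounded_norm_matrix_vector order_trans[OF norm_triangle_ineq])

lemma exp_bounded_norm_E: "exp_bounded (\<lambda>z. norm (E x z))"
  unfolding euler_step_def by (rule exp_bounded_norm_affine)

lemma exp_bounded_norm_DE: "exp_bounded (\<lambda>z. norm (DE x z u))"
  unfolding DE_def by (rule exp_bounded_norm_affine)

lemma continuous_on_E [continuous_intros]: "continuous_on UNIV (\<lambda>z. E x z)"
  unfolding euler_step_def by (intro continuous_intros)

lemma continuous_on_DE [continuous_intros]: "continuous_on UNIV (\<lambda>z. DE x z u)"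
  unfolding DE_def by (intro continuous_intros)

text \<open>For fixed \<open>x\<close> and \<open>u\<close>, \<open>DE x z u\<close> is affine in
  \<open>z\<close>. Pathwise its growth factor is only \<open>1 + O(sqrt h)\<close>, but the centred
  noise contributes no cross term to the second moment, which leaves
  \<open>1 + O(h)\<close>.\<close>

lemma
  shows integrable_norm_DE_square: "integrable std_gaussian (\<lambda>z. (norm (DE x z u))\<^sup>2)"
    and integral_norm_DE_square: "(\<integral>z. (norm (DE x z u))\<^sup>2 \<partial>std_gaussian)
      \<le> (1 + h * moment_rate CARD('q) h Kb Ks) * (norm u)\<^sup>2"
proof -
  let ?\<alpha> = "u + h *\<^sub>R fderiv b x u" and ?\<beta> = "sqrt h *\<^sub>R fderiv s x u"
  have eq: "DE x z u = ?\<alpha> + ?\<beta> *v z" for z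
    by (simp add: DE_def matrix_vector_mult.scaleR_left)
  show "integrable std_gaussian (\<lambda>z. (norm (DE x z u))\<^sup>2)"
    unfolding eq by (rule integrable_norm_affine_square)
  have "norm ?\<alpha> \<le> (1 + h * Kb) * norm u"
    using norm_triangle_ineq[of u "h *\<^sub>R fderiv b x u"] mult_left_mono[OF Kb less_imp_le[OF h_pos], of x u] h_pos
    by (simp only: norm_scaleR abs_of_pos distrib_right mult_1 mult.assoc)
  then have 1: "(norm ?\<alpha>)\<^sup>2 \<le> ((1 + h * Kb) * norm u)\<^sup>2"
    by (intro power_mono) auto
  \<comment> \<open>The squared Frobenius norm is regrouped by columns, the images of unit vectors;
    one operator-norm bound per column gives the factor \<open>CARD('q)\<close>.\<close>
  have "(\<Sum>k\<in>UNIV. (norm (?\<beta> $ k))\<^sup>2) = (\<Sum>k\<in>UNIV. \<Sum>j\<in>UNIV. (?\<beta> $ k $ j)\<^sup>2)"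
    unfolding power2_norm_eq_inner inner_vec_def by (simp add: power2_eq_square)
  also have "\<dots> = (\<Sum>j\<in>UNIV. \<Sum>k\<in>UNIV. (?\<beta> $ k $ j)\<^sup>2)" by (rule sum.swap)
  also have "\<dots> = (\<Sum>j\<in>UNIV. (norm (?\<beta> *v axis j 1))\<^sup>2)"
    unfolding power2_norm_eq_inner inner_vec_def
    by (simp add: power2_eq_square matrix_vector_mult_basis column_def)
  also have "\<dots> \<le> (\<Sum>j\<in>(UNIV::'q set). h * (Ks * norm u)\<^sup>2)"
  proof (rule sum_mono)
    fix j
    have "norm (?\<beta> *v axis j 1) \<le> sqrt h * (Ks * norm u * 1)"
      using mult_left_mono[OF Ks[of x u "axis j 1"], of "sqrt h"] h_pos
      by (simp add: matrix_vector_mult.scaleR_left norm_axis_1)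
    then have "(norm (?\<beta> *v axis j 1))\<^sup>2 \<le> (sqrt h * (Ks * norm u * 1))\<^sup>2"
      by (intro power_mono) auto
    then show "(norm (?\<beta> *v axis j 1))\<^sup>2 \<le> h * (Ks * norm u)\<^sup>2"
      using h_pos by (simp add: power_mult_distrib)
  qed
  finally have "(\<Sum>k\<in>UNIV. (norm (?\<beta> $ k))\<^sup>2) \<le> CARD('q) * (h * (Ks * norm u)\<^sup>2)" by simp
  with 1 show "(\<integral>z. (norm (DE x z u))\<^sup>2 \<partial>std_gaussian)
      \<le> (1 + h * moment_rate CARD('q) h Kb Ks) * (norm u)\<^sup>2"
    unfolding eq integral_norm_affine_square moment_rate_def by (simp add: power2_eq_square algebra_simps)
qed

text \<open>Row \<open>k\<close> of \<open>A ** transpose S\<close> is \<open>S *v (A $ k)\<close>,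
  so \<open>K2\<close> bounds \<open>s x\<close> applied to rows of the second partials. Expanding
  \<open>u\<close> and \<open>v\<close> in coordinates gives \<open>CARD('d) ^ 2\<close> such
  terms.\<close>

lemma norm_s_D2_row_le:
  assumes "norm u \<le> 1" "norm v \<le> 1"
  shows "norm (s x *v (D2 s x u v $ k)) \<le> real CARD('d) ^ 2 * K2"
proof -
  have row: "(A ** transpose S) $ k = S *v (A $ k)" for A S :: "real^'q^'d"
    by (simp add: vec_eq_iff matrix_matrix_mult_def matrix_vector_mult_def transpose_def mult.commute)
  have e: "x = (\<Sum>i\<in>UNIV. (x $ i) *\<^sub>R axis i 1)" for x :: "real^'d"
    using basis_expansion[of x] by (simp add: scalar_mult_eq_scaleR)
  have "D2 s x u v = (\<Sum>i\<in>UNIV. \<Sum>j\<in>UNIV. (u $ i * v $ j) *\<^sub>R partial2 i j s x)"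
    unfolding partial2_def D2_def
    by (subst e[of u], subst e[of v])
       (simp add: blinfun.sum_right blinfun.sum_left blinfun.scaleR_right blinfun.scaleR_left scaleR_sum_right,
        rule trans[OF sum.swap], simp add: mult.commute)
  then have "s x *v (D2 s x u v $ k) = (\<Sum>i\<in>UNIV. \<Sum>j\<in>UNIV. (u $ i * v $ j) *\<^sub>R (s x *v (partial2 i j s x $ k)))"
    by (simp add: matrix_vector_mult.sum_right matrix_vector_mult.scaleR_right)
  also have "norm \<dots> \<le> (\<Sum>i\<in>(UNIV::'d set). \<Sum>j\<in>(UNIV::'d set). K2)"
  proof (intro sum_norm_le)
    fix i j
    have "\<bar>u $ i\<bar> \<le> 1" "\<bar>v $ j\<bar> \<le> 1"
      using assms component_le_norm_cart[of u i] component_le_norm_cart[of v j] by auto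
    then have "\<bar>u $ i * v $ j\<bar> \<le> 1" by (simp add: abs_mult mult_le_one)
    moreover have "norm (s x *v (partial2 i j s x $ k)) \<le> K2"
      unfolding row[symmetric] by (rule norm_row_le[OF K2 K2_nonneg])
    ultimately show "norm ((u $ i * v $ j) *\<^sub>R (s x *v (partial2 i j s x $ k))) \<le> K2"
      using mult_mono[of "\<bar>u $ i * v $ j\<bar>" 1 "norm (s x *v (partial2 i j s x $ k))" K2] by simp
  qed
  finally show ?thesis by (simp add: power2_eq_square mult.assoc)
qed

lemma measurable_lipE [measurable]: "lipE \<in> borel_measurable borel"
  unfolding lipE_def by measurable

text \<open>A gradient of linear growth makes \<open>f\<close> grow at most quadratically, so every
  integrand is exponentially bounded in the noise.\<close>

lemma
  assumes f: "linear_growth_grad f g"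
  shows integrable_f_E: "integrable std_gaussian (\<lambda>z. f (E x z))"
    and integrable_g_DE: "integrable std_gaussian (\<lambda>z. g (E x z) \<bullet> DE x z u)"
    and has_derivative_euler_trans:
      "(euler_trans h b s f has_derivative (\<lambda>u. \<integral>z. g (E x z) \<bullet> DE x z u \<partial>std_gaussian)) (at x)"
proof -
  obtain A where A: "A \<ge> 0" "\<And>x. norm (g x) \<le> A * (1 + norm x)" and G: "\<And>x. GDERIV f x :> g x"
    using f unfolding linear_growth_grad_def by blast
  have f': "(f has_derivative (\<lambda>u. u \<bullet> g y)) (at y)" for y
    using G by (simp add: gderiv_def)
  have "continuous_on UNIV f"
    using has_derivative_continuous[OF f'] by (auto intro: continuous_at_imp_continuous_on)
  then have meas: "(\<lambda>z. f (E x z)) \<in> borel_measurable borel" for x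
    by (intro borel_measurable_continuous_onI continuous_on_compose2[OF _ continuous_on_E]) auto
  have "exp_bounded (\<lambda>z. f (E x z))" for x
  proof (rule exp_bounded_mono)
    show "exp_bounded (\<lambda>z. \<bar>f 0\<bar> + A * (1 + 0 + norm (E x z)) * norm (E x z))"
      by (intro exp_bounded_intros exp_bounded_norm_E)
    fix z
    show "\<bar>f (E x z)\<bar> \<le> \<bar>f 0\<bar> + A * (1 + 0 + norm (E x z)) * norm (E x z)"
      using linear_growth_increment[OF G A, of "E x z" 0] by simp
  qed
  then have int: "integrable std_gaussian (\<lambda>z. f (E x z))" for x
    by (rule integrable_std_gaussian_exp_bounded[OF _ meas])
  then show "integrable std_gaussian (\<lambda>z. f (E x z))" .
  \<comment> \<open>For \<open>dist x' x < 1\<close> the Euler points move by at most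
    \<open>lipE z\<close>, so the first factor bounds the gradient of \<open>f\<close> on the
    segment between them.\<close>
  let ?K = "\<lambda>z. A * (1 + norm (E x z) + lipE z) * lipE z"
  have deriv: "((\<lambda>x. f (E x z)) has_derivative (\<lambda>u. g (E x z) \<bullet> DE x z u)) (at x)" for z
    using has_derivative_compose[OF has_derivative_E f'] by (simp add: inner_commute)
  have "exp_bounded ?K"
    by (intro exp_bounded_intros exp_bounded_norm_E exp_bounded_lipE)
  moreover have "(\<lambda>z. E x z) \<in> borel_measurable borel"
    by (intro borel_measurable_continuous_onI continuous_on_E)
  ultimately have K: "integrable std_gaussian ?K"
    by (intro integrable_std_gaussian_exp_bounded) (measurable, simp_all add: measurable_lipE)
  have lip: "eventually (\<lambda>x'. \<forall>z. \<bar>f (E x' z) - f (E x z)\<bar> \<le> ?K z * norm (x' - x)) (at x)"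
    unfolding eventually_at
  proof (intro exI[of _ 1] conjI ballI impI allI)
    fix x' z assume x': "x' \<noteq> x \<and> dist x' x < 1"
    have l: "norm (E x' z - E x z) \<le> lipE z * norm (x' - x)" by (rule norm_E_diff_le)
    also have "\<dots> \<le> lipE z * 1"
      using x' lipE_nonneg by (intro mult_left_mono) (auto simp: dist_norm)
    finally have l1: "norm (E x' z - E x z) \<le> lipE z" by simp
    have "\<bar>f (E x' z) - f (E x z)\<bar> \<le> A * (1 + norm (E x z) + norm (E x' z - E x z)) * norm (E x' z - E x z)"
      by (rule linear_growth_increment[OF G A])
    also have "\<dots> \<le> A * (1 + norm (E x z) + lipE z) * (lipE z * norm (x' - x))"
      using l l1 A(1) lipE_nonneg[of z] by (intro mult_mono add_mono mult_left_mono) auto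
    finally show "\<bar>f (E x' z) - f (E x z)\<bar> \<le> ?K z * norm (x' - x)" by (simp add: mult.assoc)
  qed simp
  show "integrable std_gaussian (\<lambda>z. g (E x z) \<bullet> DE x z u)"
    by (rule integrable_derivative_dominated[OF int deriv lip K])
  show "(euler_trans h b s f has_derivative (\<lambda>u. \<integral>z. g (E x z) \<bullet> DE x z u \<partial>std_gaussian)) (at x)"
    using has_derivative_integral_dominated[OF int deriv lip K]
    by (simp add: euler_trans_def[abs_def])
qed

lemma
  assumes "linear_growth_grad f g"
  shows GDERIV_euler_trans: "GDERIV (euler_trans h b s f) x :> grad (euler_trans h b s f) x"
    and inner_grad_euler_trans:
      "u \<bullet> grad (euler_trans h b s f) x = (\<integral>z. g (E x z) \<bullet> DE x z u \<partial>std_gaussian)"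
proof -
  note D = has_derivative_euler_trans[OF assms, of x]
  show G: "GDERIV (euler_trans h b s f) x :> grad (euler_trans h b s f) x"
    using GDERIV_of_has_derivative[OF D] grad_eq[OF GDERIV_of_has_derivative[OF D]] by simp
  show "u \<bullet> grad (euler_trans h b s f) x = (\<integral>z. g (E x z) \<bullet> DE x z u \<partial>std_gaussian)"
    using has_derivative_unique[OF G[unfolded gderiv_def] D] by (rule fun_cong)
qed

text \<open>Since \<open>norm (E x z) \<le> norm (E 0 z) + lipE z * norm x\<close>, the growth in
  \<open>x\<close> factors out of the integral, leaving the moments \<open>?I1\<close> and
  \<open>?I2\<close> in the constant.\<close>

lemma linear_growth_grad_euler_trans:
  assumes f: "linear_growth_grad f g"
  shows "linear_growth_grad (euler_trans h b s f) (grad (euler_trans h b s f))"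
proof -
  obtain A where A: "A \<ge> 0" "\<And>x. norm (g x) \<le> A * (1 + norm x)"
    using f unfolding linear_growth_grad_def by blast
  have [measurable]: "(\<lambda>z. E x z) \<in> borel_measurable borel" for x
    by (intro borel_measurable_continuous_onI continuous_on_E)
  have i1: "integrable std_gaussian (\<lambda>z. (1 + norm (E 0 z)) * lipE z)"
    by (rule integrable_std_gaussian_exp_bounded,
        intro exp_bounded_intros exp_bounded_norm_E exp_bounded_lipE, measurable)
  have i2: "integrable std_gaussian (\<lambda>z. lipE z * lipE z)"
    by (rule integrable_std_gaussian_exp_bounded, intro exp_bounded_intros exp_bounded_lipE, measurable)
  let ?I1 = "\<integral>z. (1 + norm (E 0 z)) * lipE z \<partial>std_gaussian" and ?I2 = "\<integral>z. lipE z * lipE z \<partial>std_gaussian"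
  have I: "?I1 \<ge> 0" "?I2 \<ge> 0"
    using lipE_nonneg by (auto intro!: Bochner_Integration.integral_nonneg)
  have "norm (grad (euler_trans h b s f) x) \<le> A * (?I1 + ?I2) * (1 + norm x)" for x
  proof (rule norm_le_of_inner_le)
    show "0 \<le> A * (?I1 + ?I2) * (1 + norm x)" using A(1) I by simp
    fix u :: "real^'d" assume u: "norm u \<le> 1"
    have "u \<bullet> grad (euler_trans h b s f) x \<le> (\<integral>z. A * ((1 + norm (E 0 z)) * lipE z + norm x * (lipE z * lipE z)) \<partial>std_gaussian)"
      unfolding inner_grad_euler_trans[OF f]
    proof (rule integral_mono[OF integrable_g_DE[OF f]])
      show "integrable std_gaussian (\<lambda>z. A * ((1 + norm (E 0 z)) * lipE z + norm x * (lipE z * lipE z)))"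
        by (intro integrable_mult_right Bochner_Integration.integrable_add i1 i2)
      fix z
      have "norm (DE x z u) \<le> lipE z * 1"
        using u lipE_nonneg by (intro order_trans[OF norm_DE_le] mult_left_mono) auto
      moreover have "norm (E x z) \<le> norm (E 0 z) + lipE z * norm x"
        using norm_E_diff_le[of x z 0] norm_triangle_sub[of "E x z" "E 0 z"] by simp
      then have "norm (g (E x z)) \<le> A * (1 + norm (E 0 z) + lipE z * norm x)"
        using A(1) by (intro order_trans[OF A(2)] mult_left_mono) auto
      ultimately have "norm (g (E x z)) * norm (DE x z u) \<le> A * (1 + norm (E 0 z) + lipE z * norm x) * lipE z"
        using A(1) lipE_nonneg[of z] by (intro mult_mono) auto
      with norm_cauchy_schwarz[of "g (E x z)" "DE x z u"]
      show "g (E x z) \<bullet> DE x z u \<le> A * ((1 + norm (E 0 z)) * lipE z + norm x * (lipE z * lipE z))"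
        by (simp add: algebra_simps)
    qed
    also have "\<dots> = A * (?I1 + norm x * ?I2)"
      using i1 i2 by simp
    also have "\<dots> \<le> A * ((?I1 + ?I2) * (1 + norm x))"
      using A(1) I by (intro mult_left_mono) (auto simp: algebra_simps)
    finally show "u \<bullet> grad (euler_trans h b s f) x \<le> A * (?I1 + ?I2) * (1 + norm x)" by (simp add: mult.assoc)
  qed
  with GDERIV_euler_trans[OF f] A(1) I show ?thesis
    unfolding linear_growth_grad_def by (intro conjI exI[of _ "A * (?I1 + ?I2)"]) auto
qed

end

section \<open>One step on functions with Lipschitz gradient\<close>

locale euler_scheme_test = euler_scheme h b s Kb Ks K2
  for h b and s :: "real^'d \<Rightarrow> real^'q^'d" and Kb Ks K2 +
  fixes f :: "real^'d \<Rightarrow> real" and g :: "real^'d \<Rightarrow> real^'d" and L :: real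
  assumes regular: "regular_grad f g L"
begin

lemma g_lipschitz: "L-lipschitz_on UNIV g" and L_nonneg: "L \<ge> 0"
  and has_derivative_g: "(g has_derivative blinfun_apply (fderiv g y)) (at y)"
  using regular lipschitz_on_nonneg
  by (auto simp: regular_grad_def intro: has_derivative_fderiv)

lemma norm_g_diff_le: "norm (g x - g y) \<le> L * norm (x - y)"
  using lipschitz_on_normD[OF g_lipschitz] by simp

lemma norm_Dg_le: "norm (fderiv g y u) \<le> L * norm u"
  by (rule norm_derivative_le_lipschitz[OF g_lipschitz has_derivative_g])

lemma continuous_on_g: "continuous_on S g"
  using has_derivative_continuous[OF has_derivative_g]
  by (auto intro: continuous_at_imp_continuous_on)

lemma exp_bounded_g: "exp_bounded (\<lambda>z. norm (g (E x z)))"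
proof (rule exp_bounded_mono)
  show "exp_bounded (\<lambda>z. norm (g 0) + L * norm (E x z))"
    by (intro exp_bounded_intros exp_bounded_norm_E)
  fix z
  show "\<bar>norm (g (E x z))\<bar> \<le> norm (g 0) + L * norm (E x z)"
    using norm_triangle_sub[of "g (E x z)" "g 0"] norm_g_diff_le[of "E x z" 0] by simp
qed

lemma measurable_g_E [measurable]: "(\<lambda>z. g (E x z)) \<in> borel_measurable borel"
  by (intro borel_measurable_continuous_onI continuous_on_compose2[OF continuous_on_g[of UNIV] continuous_on_E]) auto

lemma measurable_DE [measurable]: "(\<lambda>z. DE x z u) \<in> borel_measurable borel"
  by (intro borel_measurable_continuous_onI continuous_on_DE)

lemma integrable_g_inner:
  assumes "exp_bounded (\<lambda>z. norm (w z))" "w \<in> borel_measurable borel"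
  shows "integrable std_gaussian (\<lambda>z. g (E x z) \<bullet> w z)"
proof (rule integrable_std_gaussian_exp_bounded)
  show "exp_bounded (\<lambda>z. g (E x z) \<bullet> w z)"
    by (rule exp_bounded_mono[OF exp_bounded_mult[OF exp_bounded_g assms(1)]]) (rule Cauchy_Schwarz_ineq2)
qed (use assms in measurable)

text \<open>The constants come from differentiability of \<open>Db\<close> and
  \<open>D\<sigma>\<close> at \<open>x\<close> and may depend on \<open>x\<close> and
  \<open>v\<close>; what matters is that the bound is affine in \<open>norm z\<close>.\<close>

lemma DE_locally_lipschitz:
  obtains c d where "eventually (\<lambda>x'. \<forall>z. norm (DE x' z v - DE x z v) \<le> (c + d * norm z) * norm (x' - x)) (at x)"
    "c \<ge> 0" "d \<ge> 0"
proof -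
  obtain c1 where c1: "c1 \<ge> 0" "eventually (\<lambda>x'. norm (fderiv b x' v - fderiv b x v) \<le> c1 * norm (x' - x)) (at x)"
    using has_derivative_locally_lipschitz[OF has_derivative_fderiv_b] by blast
  obtain c2 where c2: "c2 \<ge> 0" "eventually (\<lambda>x'. norm (fderiv s x' v - fderiv s x v) \<le> c2 * norm (x' - x)) (at x)"
    using has_derivative_locally_lipschitz[OF has_derivative_fderiv_s] by blast
  obtain B where B: "B \<ge> 0" "\<And>A z. norm ((A :: real^'q^'d) *v z) \<le> norm A * norm z * B"
    using matrix_vector_mult.nonneg_bounded by blast
  have "eventually (\<lambda>x'. \<forall>z. norm (DE x' z v - DE x z v) \<le> (h * c1 + sqrt h * c2 * B * norm z) * norm (x' - x)) (at x)"
    using c1(2) c2(2)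
  proof eventually_elim
    case (elim x')
    show ?case
    proof
      fix z
      have "DE x' z v - DE x z v = h *\<^sub>R (fderiv b x' v - fderiv b x v) + sqrt h *\<^sub>R ((fderiv s x' v - fderiv s x v) *v z)"
        by (simp add: DE_def matrix_vector_mult.diff_left scaleR_diff_right)
      then have "norm (DE x' z v - DE x z v) \<le> h * norm (fderiv b x' v - fderiv b x v) + sqrt h * norm ((fderiv s x' v - fderiv s x v) *v z)"
        using norm_triangle_ineq[of "h *\<^sub>R (fderiv b x' v - fderiv b x v)" "sqrt h *\<^sub>R ((fderiv s x' v - fderiv s x v) *v z)"] h_pos
        by simp
      also have "\<dots> \<le> h * (c1 * norm (x' - x)) + sqrt h * ((c2 * norm (x' - x)) * norm z * B)"
        using h_pos elim B by (intro add_mono mult_left_mono order_trans[OF B(2)] mult_right_mono) auto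
      finally show "norm (DE x' z v - DE x z v) \<le> (h * c1 + sqrt h * c2 * B * norm z) * norm (x' - x)"
        by (simp add: algebra_simps)
    qed
  qed
  then show ?thesis using that h_pos c1(1) c2(1) B(1) by auto
qed

lemma
  shows integrable_second_derivative: "integrable std_gaussian
      (\<lambda>z. g (E x z) \<bullet> D2E x z u v + fderiv g (E x z) (DE x z u) \<bullet> DE x z v)"
    and has_derivative_euler_trans_derivative:
      "((\<lambda>x. \<integral>z. g (E x z) \<bullet> DE x z v \<partial>std_gaussian) has_derivative
        (\<lambda>u. \<integral>z. g (E x z) \<bullet> D2E x z u v + fderiv g (E x z) (DE x z u) \<bullet> DE x z v \<partial>std_gaussian)) (at x)"
proof -
  obtain c d where cd: "c \<ge> 0" "d \<ge> 0"
      "eventually (\<lambda>x'. \<forall>z. norm (DE x' z v - DE x z v) \<le> (c + d * norm z) * norm (x' - x)) (at x)"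
    using DE_locally_lipschitz by blast
  \<comment> \<open>The increment of the inner product is split as
    \<open>g(E x' z) \<bullet> (DE x' z v - DE x z v)\<close> plus
    \<open>(g(E x' z) - g(E x z)) \<bullet> DE x z v\<close>; the first bracket bounds
    \<open>g(E x' z)\<close> for \<open>dist x' x < 1\<close>.\<close>
  let ?K = "\<lambda>z. (norm (g (E x z)) + L * lipE z) * (c + d * norm z) + L * lipE z * norm (DE x z v)"
  have int: "integrable std_gaussian (\<lambda>z. g (E x z) \<bullet> DE x z v)" for x
    by (intro integrable_g_inner exp_bounded_norm_DE measurable_DE)
  have deriv: "((\<lambda>x. g (E x z) \<bullet> DE x z v) has_derivative
      (\<lambda>u. g (E x z) \<bullet> D2E x z u v + fderiv g (E x z) (DE x z u) \<bullet> DE x z v)) (at x)" for z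
    by (intro has_derivative_inner has_derivative_compose[OF has_derivative_E has_derivative_g] has_derivative_DE)
  have "exp_bounded ?K"
    by (intro exp_bounded_intros exp_bounded_g exp_bounded_lipE exp_bounded_norm_DE)
  then have K: "integrable std_gaussian ?K"
    by (rule integrable_std_gaussian_exp_bounded) measurable
  have "eventually (\<lambda>x'. dist x' x < 1) (at x)"
    unfolding eventually_at by (intro exI[of _ 1]) auto
  with cd(3) have lip: "eventually (\<lambda>x'. \<forall>z. \<bar>g (E x' z) \<bullet> DE x' z v - g (E x z) \<bullet> DE x z v\<bar> \<le> ?K z * norm (x' - x)) (at x)"
  proof eventually_elim
    case (elim x')
    show ?case
    proof
      fix z
      have l: "norm (g (E x' z) - g (E x z)) \<le> L * (lipE z * norm (x' - x))"
        using norm_g_diff_le[of "E x' z" "E x z"] mult_left_mono[OF norm_E_diff_le[of x' z x] L_nonneg] by linarith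
      also have "\<dots> \<le> L * (lipE z * 1)"
        using elim lipE_nonneg L_nonneg by (intro mult_left_mono) (auto simp: dist_norm)
      finally have l1: "norm (g (E x' z)) \<le> norm (g (E x z)) + L * lipE z"
        using norm_triangle_sub[of "g (E x' z)" "g (E x z)"] by simp
      have "g (E x' z) \<bullet> DE x' z v - g (E x z) \<bullet> DE x z v =
          g (E x' z) \<bullet> (DE x' z v - DE x z v) + (g (E x' z) - g (E x z)) \<bullet> DE x z v"
        by (simp add: inner_diff_left inner_diff_right)
      then have "\<bar>g (E x' z) \<bullet> DE x' z v - g (E x z) \<bullet> DE x z v\<bar> \<le>
          norm (g (E x' z)) * norm (DE x' z v - DE x z v) + norm (g (E x' z) - g (E x z)) * norm (DE x z v)"
        using Cauchy_Schwarz_ineq2[of "g (E x' z)" "DE x' z v - DE x z v"]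
          Cauchy_Schwarz_ineq2[of "g (E x' z) - g (E x z)" "DE x z v"] by linarith
      also have "\<dots> \<le> (norm (g (E x z)) + L * lipE z) * ((c + d * norm z) * norm (x' - x))
          + L * (lipE z * norm (x' - x)) * norm (DE x z v)"
        using l l1 elim L_nonneg lipE_nonneg[of z] by (intro mult_mono add_mono mult_right_mono) auto
      finally show "\<bar>g (E x' z) \<bullet> DE x' z v - g (E x z) \<bullet> DE x z v\<bar> \<le> ?K z * norm (x' - x)"
        by (simp add: algebra_simps)
    qed
  qed
  show "integrable std_gaussian
      (\<lambda>z. g (E x z) \<bullet> D2E x z u v + fderiv g (E x z) (DE x z u) \<bullet> DE x z v)"
    by (rule integrable_derivative_dominated[OF int deriv lip K])
  show "((\<lambda>x. \<integral>z. g (E x z) \<bullet> DE x z v \<partial>std_gaussian) has_derivative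
        (\<lambda>u. \<integral>z. g (E x z) \<bullet> D2E x z u v + fderiv g (E x z) (DE x z u) \<bullet> DE x z v \<partial>std_gaussian)) (at x)"
    by (rule has_derivative_integral_dominated[OF int deriv lip K])
qed

abbreviation "grad_step \<equiv> grad (euler_trans h b s f)"

lemma linear_growth: "linear_growth_grad f g"
  by (rule linear_growth_grad_of_regular[OF regular])

lemmas GDERIV_grad_step = GDERIV_euler_trans[OF linear_growth]
lemmas inner_grad_step = inner_grad_euler_trans[OF linear_growth]

lemma grad_step_differentiable: "grad_step differentiable (at x)"
proof -
  let ?G = "\<lambda>x. \<Sum>v\<in>Basis. (\<integral>z. g (E x z) \<bullet> DE x z v \<partial>std_gaussian) *\<^sub>R v"
  have "grad_step x = ?G x" for x
    using euclidean_representation[of "grad_step x"]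
    by (simp add: inner_grad_step[symmetric] inner_commute[of "grad_step x"])
  then have "grad_step = ?G" by (rule ext)
  moreover have "?G differentiable (at x)"
    unfolding differentiable_def
    by (rule exI, rule has_derivative_sum, rule has_derivative_scaleR_left,
        rule has_derivative_euler_trans_derivative)
  ultimately show ?thesis by (simp only:)
qed

lemma integral_norm_DE_square_unit:
  assumes "norm u \<le> 1"
  shows "(\<integral>z. (norm (DE x z u))\<^sup>2 \<partial>std_gaussian) \<le> 1 + h * moment_rate CARD('q) h Kb Ks"
proof -
  have "0 \<le> 1 + h * moment_rate CARD('q) h Kb Ks" using h_pos moment_rate_nonneg by simp
  moreover have "(norm u)\<^sup>2 \<le> 1" using assms by (simp add: power_le_one)
  ultimately have "(1 + h * moment_rate CARD('q) h Kb Ks) * (norm u)\<^sup>2 \<le> (1 + h * moment_rate CARD('q) h Kb Ks) * 1" by (intro mult_left_mono)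
  with integral_norm_DE_square[of x u] show ?thesis by simp
qed

text \<open>The inequality \<open>r \<le> (1 + r\<^sup>2) / 2\<close> reduces the first moment of
  \<open>norm (DE x Z u)\<close> to the second, avoiding the pathwise loss of order
  \<open>sqrt h\<close>.\<close>

lemma norm_grad_step_le:
  assumes S: "S \<ge> 0" "\<And>y. norm (g y) \<le> S"
  shows "norm (grad_step x) \<le> (1 + h * moment_rate CARD('q) h Kb Ks) * S"
proof (rule norm_le_of_inner_le)
  interpret gauss: prob_space "std_gaussian :: (real^'q) measure" by (rule prob_space_std_gaussian)
  have kn: "0 \<le> h * moment_rate CARD('q) h Kb Ks" using h_pos moment_rate_nonneg by simp
  then show "(1 + h * moment_rate CARD('q) h Kb Ks) * S \<ge> 0" using S by (intro mult_nonneg_nonneg) auto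
  fix u :: "real^'d" assume u: "norm u \<le> 1"
  have "u \<bullet> grad_step x \<le> (\<integral>z. S * ((1 + (norm (DE x z u))\<^sup>2) / 2) \<partial>std_gaussian)"
    unfolding inner_grad_step
  proof (rule integral_mono)
    show "integrable std_gaussian (\<lambda>z. g (E x z) \<bullet> DE x z u)"
      by (intro integrable_g_inner exp_bounded_norm_DE measurable_DE)
    show "integrable std_gaussian (\<lambda>z. S * ((1 + (norm (DE x z u))\<^sup>2) / 2))"
      using integrable_norm_DE_square by simp
    fix z
    have "g (E x z) \<bullet> DE x z u \<le> norm (g (E x z)) * norm (DE x z u)" by (rule norm_cauchy_schwarz)
    also have "\<dots> \<le> S * norm (DE x z u)" by (intro mult_right_mono S) auto
    also have "norm (DE x z u) \<le> (1 + (norm (DE x z u))\<^sup>2) / 2"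
      using zero_le_power2[of "norm (DE x z u) - 1"] by (simp add: power2_diff)
    finally show "g (E x z) \<bullet> DE x z u \<le> S * ((1 + (norm (DE x z u))\<^sup>2) / 2)"
      using S(1) by (auto simp: mult_left_mono)
  qed
  also have "\<dots> = S * ((1 + (\<integral>z. (norm (DE x z u))\<^sup>2 \<partial>std_gaussian)) / 2)"
    using integrable_norm_DE_square gauss.prob_space by simp
  also have "\<dots> \<le> S * (1 + h * moment_rate CARD('q) h Kb Ks)"
    using integral_norm_DE_square_unit[OF u, of x] kn S(1) by (intro mult_left_mono) auto
  finally show "u \<bullet> grad_step x \<le> (1 + h * moment_rate CARD('q) h Kb Ks) * S" by (simp add: mult.commute)
qed

text \<open>The Hessian is bounded by \<open>L\<close>, and the product of the norms of
  \<open>DE x z u\<close> and \<open>DE x z v\<close> by the mean of their squares.\<close>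

lemma abs_integral_hessian_le:
  assumes u: "norm u \<le> 1" and v: "norm v \<le> 1"
    and int: "integrable std_gaussian (\<lambda>z. fderiv g (E x z) (DE x z u) \<bullet> DE x z v)"
  shows "\<bar>\<integral>z. fderiv g (E x z) (DE x z u) \<bullet> DE x z v \<partial>std_gaussian\<bar> \<le> L * (1 + h * moment_rate CARD('q) h Kb Ks)"
proof -
  have "\<bar>\<integral>z. fderiv g (E x z) (DE x z u) \<bullet> DE x z v \<partial>std_gaussian\<bar>
      \<le> (\<integral>z. L * (((norm (DE x z u))\<^sup>2 + (norm (DE x z v))\<^sup>2) / 2) \<partial>std_gaussian)"
  proof (rule integral_abs_bound_integral[OF int])
    show "integrable std_gaussian (\<lambda>z. L * (((norm (DE x z u))\<^sup>2 + (norm (DE x z v))\<^sup>2) / 2))"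
      using integrable_norm_DE_square by simp
    fix z
    have "\<bar>fderiv g (E x z) (DE x z u) \<bullet> DE x z v\<bar> \<le> norm (fderiv g (E x z) (DE x z u)) * norm (DE x z v)"
      by (rule Cauchy_Schwarz_ineq2)
    also have "\<dots> \<le> L * norm (DE x z u) * norm (DE x z v)"
      by (intro mult_right_mono norm_Dg_le) auto
    also have "\<dots> \<le> L * (((norm (DE x z u))\<^sup>2 + (norm (DE x z v))\<^sup>2) / 2)"
      unfolding mult.assoc using sum_squares_bound[of "norm (DE x z u)" "norm (DE x z v)"] L_nonneg
      by (intro mult_left_mono) auto
    finally show "\<bar>fderiv g (E x z) (DE x z u) \<bullet> DE x z v\<bar> \<le> L * (((norm (DE x z u))\<^sup>2 + (norm (DE x z v))\<^sup>2) / 2)" .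
  qed
  also have "\<dots> = L * (((\<integral>z. (norm (DE x z u))\<^sup>2 \<partial>std_gaussian) + (\<integral>z. (norm (DE x z v))\<^sup>2 \<partial>std_gaussian)) / 2)"
    using integrable_norm_DE_square by simp
  also have "\<dots> \<le> L * (1 + h * moment_rate CARD('q) h Kb Ks)"
    using integral_norm_DE_square_unit[OF u, of x] integral_norm_DE_square_unit[OF v, of x] L_nonneg
    by (intro mult_left_mono) auto
  finally show ?thesis .
qed

text \<open>Stein's identity trades the factor \<open>z\<close> for a derivative of \<open>g (E x z)\<close> in \<open>z\<close>, which
  produces the second factor \<open>sqrt h\<close> and the matrix \<open>s x\<close> next to the possibly unbounded
  \<open>D2 s x u v\<close>.\<close>

lemma abs_integral_D2s_le:
  assumes u: "norm u \<le> 1" and v: "norm v \<le> 1"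
  shows "\<bar>\<integral>z. g (E x z) \<bullet> (sqrt h *\<^sub>R (D2 s x u v *v z)) \<partial>std_gaussian\<bar> \<le> L * (h * (real CARD('d) ^ 3 * K2))"
proof -
  interpret gauss: prob_space "std_gaussian :: (real^'q) measure" by (rule prob_space_std_gaussian)
  define A where "A = D2 s x u v"
  let ?\<phi>' = "\<lambda>k z w. fderiv g (E x z) (sqrt h *\<^sub>R (s x *v w)) $ k"
  obtain B where B: "B \<ge> 0" "\<And>w. norm (s x *v w) \<le> norm w * B"
    using bounded_linear.nonneg_bounded[OF matrix_vector_mul_bounded_linear[of "s x"]] by blast
  \<comment> \<open>Stein's identity is used for each component \<open>k\<close> of
    \<open>g (E x z)\<close>, with row \<open>A $ k\<close> as direction; the sum over
    \<open>k\<close> is the trace of the Hessian of \<open>f\<close> against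
    \<open>D\<^sup>2\<sigma>\<close> times the transpose of \<open>\<sigma>\<close>.\<close>
  have deriv: "((\<lambda>z. g (E x z) $ k) has_derivative ?\<phi>' k z) (at z)" for k z
    by (rule bounded_linear.has_derivative[OF bounded_linear_vec_nth
        has_derivative_compose[OF has_derivative_E_noise has_derivative_g]])
  have lip: "\<bar>g (E x z) $ k - g (E x y) $ k\<bar> \<le> (L * (sqrt h * B)) * norm (z - y)" for k z y
  proof -
    have "\<bar>g (E x z) $ k - g (E x y) $ k\<bar> \<le> norm (g (E x z) - g (E x y))"
      using component_le_norm_cart[of "g (E x z) - g (E x y)" k] by simp
    also have "\<dots> \<le> L * norm (E x z - E x y)" by (rule norm_g_diff_le)
    also have "norm (E x z - E x y) = sqrt h * norm (s x *v (z - y))"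
      using h_pos by (simp add: euler_step_def matrix_vector_mult.diff_right flip: scaleR_diff_right)
    also have "L * (sqrt h * norm (s x *v (z - y))) \<le> L * (sqrt h * (norm (z - y) * B))"
      using h_pos L_nonneg B by (intro mult_left_mono) auto
    finally show ?thesis by (simp add: mult_ac)
  qed
  have int: "integrable std_gaussian (\<lambda>z. g (E x z) $ k * (A $ k \<bullet> z))" for k
  proof (rule integrable_std_gaussian_exp_bounded)
    show "exp_bounded (\<lambda>z. g (E x z) $ k * (A $ k \<bullet> z))"
      by (intro exp_bounded_mult exp_bounded_mono[OF exp_bounded_g[of x]]
          exp_bounded_mono[OF exp_bounded_mult[OF exp_bounded_const[of "norm (A $ k)"] exp_bounded_norm]]
          component_le_norm_cart Cauchy_Schwarz_ineq2)
    show "(\<lambda>z. g (E x z) $ k * (A $ k \<bullet> z)) \<in> borel_measurable borel"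
      by (intro borel_measurable_continuous_onI continuous_intros
          continuous_on_compose2[OF continuous_on_g[of UNIV] continuous_on_E]) auto
  qed
  have stein: "\<bar>\<integral>z. g (E x z) $ k * (A $ k \<bullet> z) \<partial>std_gaussian\<bar> \<le> sqrt h * (L * (real CARD('d) ^ 2 * K2))" for k
  proof -
    have "\<bar>\<integral>z. ?\<phi>' k z (A $ k) \<partial>std_gaussian\<bar> \<le> (\<integral>z. sqrt h * (L * (real CARD('d) ^ 2 * K2)) \<partial>(std_gaussian :: (real^'q) measure))"
    proof (rule integral_abs_bound_integral)
      show "integrable std_gaussian (\<lambda>z. ?\<phi>' k z (A $ k))"
        by (rule integrable_stein[OF deriv lip])
      fix z
      have "\<bar>?\<phi>' k z (A $ k)\<bar> \<le> L * norm (sqrt h *\<^sub>R (s x *v (A $ k)))"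
        by (rule order_trans[OF component_le_norm_cart norm_Dg_le])
      also have "\<dots> = sqrt h * (L * norm (s x *v (A $ k)))" using h_pos by simp
      also have "\<dots> \<le> sqrt h * (L * (real CARD('d) ^ 2 * K2))"
        unfolding A_def using h_pos L_nonneg norm_s_D2_row_le[OF u v, of x k] by (intro mult_left_mono) auto
      finally show "\<bar>?\<phi>' k z (A $ k)\<bar> \<le> sqrt h * (L * (real CARD('d) ^ 2 * K2))" .
    qed simp
    then show ?thesis
      unfolding stein_identity[OF deriv lip] using gauss.prob_space by simp
  qed
  have "(\<integral>z. g (E x z) \<bullet> (sqrt h *\<^sub>R (A *v z)) \<partial>std_gaussian) = (\<integral>z. sqrt h * (\<Sum>k\<in>UNIV. g (E x z) $ k * (A $ k \<bullet> z)) \<partial>std_gaussian)"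
    by (simp add: inner_vec_def[of "g (E x _)"] matrix_vector_mult_row_nth)
  also have "\<dots> = sqrt h * (\<Sum>k\<in>UNIV. \<integral>z. g (E x z) $ k * (A $ k \<bullet> z) \<partial>std_gaussian)"
    using int by simp
  also have "\<bar>\<dots>\<bar> = sqrt h * \<bar>\<Sum>k\<in>UNIV. \<integral>z. g (E x z) $ k * (A $ k \<bullet> z) \<partial>std_gaussian\<bar>"
    using h_pos by (simp add: abs_mult)
  \<comment> \<open>Summing over the components raises the power of \<open>CARD('d)\<close> to
    three, and the two factors \<open>sqrt h\<close> combine to \<open>h\<close>.\<close>
  also have "\<dots> \<le> sqrt h * (\<Sum>k\<in>(UNIV::'d set). sqrt h * (L * (real CARD('d) ^ 2 * K2)))"
    using h_pos by (intro mult_left_mono order_trans[OF sum_abs] sum_mono stein) auto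
  also have "\<dots> = (sqrt h * sqrt h) * (L * (real CARD('d) ^ 3 * K2))"
    by (simp add: power3_eq_cube power2_eq_square)
  also have "\<dots> = L * (h * (real CARD('d) ^ 3 * K2))"
    using h_pos by simp
  finally show ?thesis unfolding A_def .
qed

text \<open>The three parts of the second derivative of \<open>P f\<close> are bounded separately.
  \<open>N\<close> controls the inner product of \<open>g\<close> with \<open>D\<^sup>2b\<close>
  directly, so an affine \<open>b\<close> can go with an unbounded \<open>g\<close>.\<close>

lemma regular_grad_step:
  assumes N: "N \<ge> 0" "\<And>x y u v. norm u \<le> 1 \<Longrightarrow> norm v \<le> 1 \<Longrightarrow> \<bar>g y \<bullet> D2 b x u v\<bar> \<le> N"
  shows "regular_grad (euler_trans h b s f) grad_step
    ((1 + h * (moment_rate CARD('q) h Kb Ks + real CARD('d) ^ 3 * K2)) * L + h * N)" (is "regular_grad _ _ ?K")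
proof -
  interpret gauss: prob_space "std_gaussian :: (real^'q) measure" by (rule prob_space_std_gaussian)
  have K0: "?K \<ge> 0" using h_pos moment_rate_nonneg K2_nonneg L_nonneg N(1) by simp
  let ?T = "\<lambda>x v u. \<integral>z. g (E x z) \<bullet> D2E x z u v + fderiv g (E x z) (DE x z u) \<bullet> DE x z v \<partial>std_gaussian"
  have unit: "\<bar>?T x v u\<bar> \<le> ?K" if u: "norm u \<le> 1" and v: "norm v \<le> 1" for x u v
  proof -
    have i1: "integrable std_gaussian (\<lambda>z. g (E x z) \<bullet> (h *\<^sub>R D2 b x u v))"
      by (intro integrable_g_inner exp_bounded_const) simp
    have i2: "integrable std_gaussian (\<lambda>z. g (E x z) \<bullet> (sqrt h *\<^sub>R (D2 s x u v *v z)))"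
      using exp_bounded_norm_affine[of 0 "sqrt h" "D2 s x u v"]
      by (intro integrable_g_inner) (auto intro!: borel_measurable_continuous_onI continuous_intros)
    have eq: "g (E x z) \<bullet> D2E x z u v = g (E x z) \<bullet> (h *\<^sub>R D2 b x u v) + g (E x z) \<bullet> (sqrt h *\<^sub>R (D2 s x u v *v z))" for z
      by (simp add: D2E_def inner_add_right)
    have i12: "integrable std_gaussian (\<lambda>z. g (E x z) \<bullet> D2E x z u v)"
      unfolding eq by (rule Bochner_Integration.integrable_add[OF i1 i2])
    \<comment> \<open>With \<open>fderiv g\<close> possibly discontinuous, integrability (and
      measurability) of this term is obtained by subtraction from the full second derivative, an
      integrable limit of difference quotients.\<close>
    have i3: "integrable std_gaussian (\<lambda>z. fderiv g (E x z) (DE x z u) \<bullet> DE x z v)"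
      using Bochner_Integration.integrable_diff[OF integrable_second_derivative[of x u v] i12] by simp
    have split: "?T x v u = (\<integral>z. g (E x z) \<bullet> (h *\<^sub>R D2 b x u v) \<partial>std_gaussian)
        + (\<integral>z. g (E x z) \<bullet> (sqrt h *\<^sub>R (D2 s x u v *v z)) \<partial>std_gaussian)
        + (\<integral>z. fderiv g (E x z) (DE x z u) \<bullet> DE x z v \<partial>std_gaussian)"
      by (subst Bochner_Integration.integral_add[OF i12 i3], unfold eq,
          subst Bochner_Integration.integral_add[OF i1 i2]) simp
    have "\<bar>\<integral>z. g (E x z) \<bullet> (h *\<^sub>R D2 b x u v) \<partial>std_gaussian\<bar> \<le> (\<integral>z. h * N \<partial>(std_gaussian :: (real^'q) measure))"
      using N(2)[OF u v] h_pos by (intro integral_abs_bound_integral i1) (auto simp: abs_mult)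
    then have "\<bar>\<integral>z. g (E x z) \<bullet> (h *\<^sub>R D2 b x u v) \<partial>std_gaussian\<bar> \<le> h * N"
      using gauss.prob_space by simp
    with abs_integral_D2s_le[OF u v, of x] abs_integral_hessian_le[OF u v i3]
    have "\<bar>?T x v u\<bar> \<le> h * N + L * (h * (real CARD('d) ^ 3 * K2)) + L * (1 + h * moment_rate CARD('q) h Kb Ks)"
      unfolding split by linarith
    also have "\<dots> = ?K" by (simp add: algebra_simps)
    finally show ?thesis .
  qed
  have "norm (grad_step x - grad_step y) \<le> ?K * norm (x - y)" for x y
  proof (rule norm_le_of_inner_le)
    fix v :: "real^'d" assume v: "norm v \<le> 1"
    have D: "((\<lambda>x. v \<bullet> grad_step x) has_derivative ?T x v) (at x)" for x
      unfolding inner_grad_step by (rule has_derivative_euler_trans_derivative)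
    have "norm (?T x v u) \<le> ?K * norm u" for x u
    proof (cases "u = 0")
      case True
      then show ?thesis using linear_0[OF has_derivative_linear[OF D, of x]] by simp
    next
      case False
      have "?T x v u = norm u * ?T x v (sgn u)"
        using linear_cmul[OF has_derivative_linear[OF D, of x], of "norm u" "sgn u"] False
        by (simp only: sgn_div_norm scaleR_scaleR real_scaleR_def) simp
      then show ?thesis
        using unit[of "sgn u" v x] v False mult_left_mono[of _ ?K "norm u"]
        by (simp add: abs_mult norm_sgn mult.commute)
    qed
    then have "?K-lipschitz_on UNIV (\<lambda>x. v \<bullet> grad_step x)"
      by (rule lipschitz_on_UNIV_of_derivative_bound[OF K0 D])
    then have "\<bar>v \<bullet> grad_step x - v \<bullet> grad_step y\<bar> \<le> ?K * norm (x - y)"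
      using lipschitz_on_normD by force
    then show "v \<bullet> (grad_step x - grad_step y) \<le> ?K * norm (x - y)" by (simp add: inner_diff_right)
  qed (use K0 in simp)
  then have "?K-lipschitz_on UNIV grad_step"
    using K0 by (intro lipschitz_onI) (auto simp: dist_norm)
  then show ?thesis
    unfolding regular_grad_def using GDERIV_grad_step grad_step_differentiable by blast
qed

end

section \<open>Iterating the transition\<close>

context euler_scheme
begin

text \<open>The product \<open>D2_sup b * sup_norm (grad f)\<close> can be infinite (then there is nothing to prove)
  and is \<open>0\<close> for affine \<open>b\<close> even if \<open>grad f\<close> is unbounded; both conventions are those of
  \<^typ>\<open>ennreal\<close>.\<close>

lemma abs_inner_D2b_le:
  assumes N: "D2_sup b * sup_norm g = ennreal N" "N \<ge> 0" and uv: "norm u \<le> 1" "norm v \<le> 1"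
  shows "\<bar>g y \<bullet> D2 b x u v\<bar> \<le> N"
proof -
  have "ennreal (norm (D2 b x u v)) \<le> D2_sup b"
    unfolding D2_sup_def using uv by (intro SUP_upper2[of x] SUP_upper2[of u] SUP_upper2[of v]) auto
  moreover have "ennreal (norm (g y)) \<le> sup_norm g"
    unfolding sup_norm_def by (intro SUP_upper) auto
  ultimately have "ennreal (norm (D2 b x u v)) * ennreal (norm (g y)) \<le> D2_sup b * sup_norm g"
    by (rule mult_mono) auto
  then have "norm (D2 b x u v) * norm (g y) \<le> N"
    using N by (simp add: ennreal_mult[symmetric])
  with Cauchy_Schwarz_ineq2[of "g y" "D2 b x u v"] show ?thesis by (simp add: mult.commute)
qed

lemma sup_norm_grad_euler_trans_le:
  assumes f: "regular_grad f g L" and C: "moment_rate CARD('q) h Kb Ks \<le> C"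
  shows "sup_norm (grad (euler_trans h b s f)) \<le> ennreal (1 + C * h) * sup_norm g"
proof -
  interpret euler_scheme_test h b s Kb Ks K2 f g L by unfold_locales (rule f)
  \<comment> \<open>Strict positivity keeps the right-hand side infinite when
    \<open>sup_norm g\<close> is.\<close>
  have C0: "1 + C * h > 0" using C moment_rate_nonneg[of "CARD('q)"] h_pos by (simp add: add_pos_nonneg)
  show ?thesis
  proof (cases "sup_norm g")
    case top
    with C0 show ?thesis by (simp add: ennreal_mult_top)
  next
    case (real S)
    then have S: "norm (g y) \<le> S" for y using sup_norm_le_iff[of S g] by simp
    have "norm (grad_step x) \<le> (1 + C * h) * S" for x
    proof (rule order_trans[OF norm_grad_step_le[OF real(1) S]])
      show "(1 + h * moment_rate CARD('q) h Kb Ks) * S \<le> (1 + C * h) * S"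
        using C h_pos real(1) by (intro mult_right_mono) (auto simp: mult.commute)
    qed
    then have "sup_norm grad_step \<le> ennreal ((1 + C * h) * S)"
      using C0 real(1) by (simp add: sup_norm_le_iff)
    with C0 real show ?thesis by (simp add: ennreal_mult)
  qed
qed

lemma
  assumes f: "regular_grad f g L"
    and C: "moment_rate CARD('q) h Kb Ks + real CARD('d) ^ 3 * K2 \<le> C"
    and fin: "D2_sup b * sup_norm g \<noteq> \<top>"
  shows regular_grad_euler_trans: "\<exists>L'. regular_grad (euler_trans h b s f) (grad (euler_trans h b s f)) L'"
    and lip_const_grad_euler_trans_le: "lip_const (grad (euler_trans h b s f))
      \<le> ennreal (1 + C * h) * lip_const g + ennreal h * (D2_sup b * sup_norm g)"
proof -
  obtain N where N: "N \<ge> 0" "D2_sup b * sup_norm g = ennreal N"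
    using fin by (cases "D2_sup b * sup_norm g") auto
  have lipg: "lip_const g \<le> ennreal L"
    using f lipschitz_on_nonneg by (subst lip_const_le_iff) (auto simp: regular_grad_def)
  \<comment> \<open>The given \<open>L\<close> is exchanged for the best Lipschitz constant, so that
    \<open>lip_const g\<close> itself enters the estimate.\<close>
  then obtain K where K: "K \<ge> 0" "lip_const g = ennreal K"
    by (cases "lip_const g") (auto simp: top_unique)
  then have "K-lipschitz_on UNIV g" using lip_const_le_iff[of K g] by simp
  then have "regular_grad f g K" using f by (simp add: regular_grad_def)
  then interpret euler_scheme_test h b s Kb Ks K2 f g K by unfold_locales
  let ?K = "(1 + h * (moment_rate CARD('q) h Kb Ks + real CARD('d) ^ 3 * K2)) * K + h * N"
  have reg: "regular_grad (euler_trans h b s f) grad_step ?K"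
    by (rule regular_grad_step[OF N(1) abs_inner_D2b_le[OF N(2,1)]])
  then show "\<exists>L'. regular_grad (euler_trans h b s f) grad_step L'" by blast
  have "?K-lipschitz_on UNIV grad_step" using reg by (simp add: regular_grad_def)
  moreover from this have "?K \<ge> 0" by (rule lipschitz_on_nonneg)
  ultimately have "lip_const grad_step \<le> ennreal ?K" by (simp add: lip_const_le_iff)
  also have "\<dots> \<le> ennreal ((1 + C * h) * K + h * N)"
    using C h_pos K(1) by (intro ennreal_leI add_mono mult_right_mono) (auto simp: mult.commute N)
  also have "\<dots> = ennreal (1 + C * h) * ennreal K + ennreal h * ennreal N"
  proof -
    have "0 \<le> moment_rate CARD('q) h Kb Ks + real CARD('d) ^ 3 * K2"
      using moment_rate_nonneg K2_nonneg by simp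
    then have "0 \<le> 1 + C * h" using C h_pos by simp
    then show ?thesis using K(1) N(1) h_pos by (simp add: ennreal_mult ennreal_plus)
  qed
  finally show "lip_const grad_step
      \<le> ennreal (1 + C * h) * lip_const g + ennreal h * (D2_sup b * sup_norm g)"
    using K N by simp
qed

abbreviation "P \<equiv> euler_trans h b s"

lemma linear_growth_grad_iterate:
  assumes "linear_growth_grad f (grad f)"
  shows "linear_growth_grad ((P ^^ k) f) (grad ((P ^^ k) f))"
  by (induction k) (use assms linear_growth_grad_euler_trans in auto)

text \<open>A discrete Gronwall induction. The sup norm of the gradient is carried along because it
  feeds the \<open>D\<^sup>2b\<close> term of the next step, and regularity because each one-step
  estimate requires it.\<close>

lemma iterate_bounds:
  assumes f: "regular_grad f (grad f) L"
    and C: "moment_rate CARD('q) h Kb Ks + real CARD('d) ^ 3 * K2 \<le> C"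
    and fin: "D2_sup b * sup_norm (grad f) \<noteq> \<top>"
  shows "(\<exists>L'. regular_grad ((P ^^ k) f) (grad ((P ^^ k) f)) L') \<and>
    sup_norm (grad ((P ^^ k) f)) \<le> ennreal ((1 + C * h) ^ k) * sup_norm (grad f) \<and>
    lip_const (grad ((P ^^ k) f)) \<le> ennreal ((1 + C * h) ^ k) *
      (lip_const (grad f) + ennreal (real k * h) * (D2_sup b * sup_norm (grad f)))"
proof (induction k)
  case 0
  then show ?case using f by auto
next
  case (Suc k)
  let ?a = "1 + C * h" and ?D = "D2_sup b * sup_norm (grad f)" and ?\<Lambda> = "lip_const (grad f)"
  let ?g = "grad ((P ^^ k) f)"
  obtain L' where reg: "regular_grad ((P ^^ k) f) ?g L'" using Suc by blast
  have d: "0 \<le> real CARD('d) ^ 3 * K2" using K2_nonneg by simp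
  then have C0: "0 \<le> C" using C moment_rate_nonneg[of "CARD('q)"] by linarith
  then have a: "?a \<ge> 1" using h_pos by simp
  have C': "moment_rate CARD('q) h Kb Ks \<le> C"
    using C d by linarith
  have D: "D2_sup b * sup_norm ?g \<le> ennreal (?a ^ k) * ?D"
  proof -
    have "D2_sup b * sup_norm ?g \<le> D2_sup b * (ennreal (?a ^ k) * sup_norm (grad f))"
      using Suc by (intro mult_left_mono) auto
    then show ?thesis by (simp only: mult_ac)
  qed
  have "ennreal (?a ^ k) * ?D < \<top>"
    using fin by (simp add: ennreal_mult_less_top top.not_eq_extremum)
  with D have fin': "D2_sup b * sup_norm ?g \<noteq> \<top>" by (auto simp: top_unique)
  have 1: "sup_norm (grad (P ((P ^^ k) f))) \<le> ennreal (?a ^ Suc k) * sup_norm (grad f)"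
  proof -
    have "sup_norm (grad (P ((P ^^ k) f))) \<le> ennreal ?a * sup_norm ?g"
      by (rule sup_norm_grad_euler_trans_le[OF reg C'])
    also have "\<dots> \<le> ennreal ?a * (ennreal (?a ^ k) * sup_norm (grad f))"
      using Suc by (intro mult_left_mono) auto
    also have "\<dots> = ennreal (?a ^ Suc k) * sup_norm (grad f)"
      using a by (simp add: ennreal_mult mult.assoc)
    finally show ?thesis .
  qed
  have "lip_const (grad (P ((P ^^ k) f))) \<le> ennreal ?a * lip_const ?g + ennreal h * (D2_sup b * sup_norm ?g)"
    by (rule lip_const_grad_euler_trans_le[OF reg C fin'])
  also have "\<dots> \<le> ennreal ?a * (ennreal (?a ^ k) * (?\<Lambda> + ennreal (real k * h) * ?D)) + ennreal h * (ennreal (?a ^ Suc k) * ?D)"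
  proof (intro add_mono mult_left_mono)
    \<comment> \<open>The new source term carries only \<open>?a ^ k\<close>; raising the exponent
      by one lets all terms share the factor \<open>?a ^ Suc k\<close>.\<close>
    show "D2_sup b * sup_norm ?g \<le> ennreal (?a ^ Suc k) * ?D"
      by (rule order_trans[OF D mult_right_mono[OF ennreal_leI[OF power_increasing]]]) (use a in auto)
  qed (use Suc in auto)
  also have "\<dots> = ennreal (?a ^ Suc k) * (?\<Lambda> + (ennreal (real k * h) + ennreal h) * ?D)"
    using a by (simp add: ennreal_mult mult.assoc) (simp add: distrib_left distrib_right mult_ac add_ac)
  also have "ennreal (real k * h) + ennreal h = ennreal (real (Suc k) * h)"
    using h_pos by (subst ennreal_plus[symmetric]) (auto simp: algebra_simps)
  finally show ?case
    using 1 regular_grad_euler_trans[OF reg C fin'] by simp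
qed

lemma euler_scheme_estimates:
  assumes f: "regular_grad f (grad f) L"
    and C: "moment_rate CARD('q) h Kb Ks + real CARD('d) ^ 3 * K2 \<le> C"
  shows "integrable std_gaussian (\<lambda>z. (P ^^ k) f (E x z))"
    and "(P ^^ k) f differentiable (at x)"
    and "lip_const (P f) \<le> ennreal (1 + C * h) * lip_const f"
    and "lip_const (grad (P f)) \<le> ennreal (1 + C * h) * lip_const (grad f)
       + ennreal h * D2_sup b * sup_norm (grad f)"
    and "lip_const (grad ((P ^^ k) f)) \<le> ennreal (exp (C * (real k * h))) *
       (lip_const (grad f) + ennreal (real k * h) * D2_sup b * sup_norm (grad f))"
proof -
  have lg: "linear_growth_grad f (grad f)" by (rule linear_growth_grad_of_regular[OF f])
  note lgk = linear_growth_grad_iterate[OF lg, of k]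
  have d: "0 \<le> real CARD('d) ^ 3 * K2" using K2_nonneg by simp
  then have C0: "0 \<le> C" using C moment_rate_nonneg[of "CARD('q)"] by linarith
  have C': "moment_rate CARD('q) h Kb Ks \<le> C"
    using C d by linarith
  show "integrable std_gaussian (\<lambda>z. (P ^^ k) f (E x z))"
    by (rule integrable_f_E[OF lgk])
  show "(P ^^ k) f differentiable (at x)"
    using lgk unfolding linear_growth_grad_def gderiv_def differentiable_def by blast
  have eq: "sup_norm (grad F) = lip_const F" if "linear_growth_grad F (grad F)" for F :: "real^'d \<Rightarrow> real"
    using that by (intro sup_norm_gradient_eq_lip_const) (simp add: linear_growth_grad_def)
  show "lip_const (P f) \<le> ennreal (1 + C * h) * lip_const f"
    using sup_norm_grad_euler_trans_le[OF f C'] eq[OF lg] eq[OF linear_growth_grad_euler_trans[OF lg]] by simp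
  show "lip_const (grad (P f)) \<le> ennreal (1 + C * h) * lip_const (grad f)
       + ennreal h * D2_sup b * sup_norm (grad f)"
  proof (cases "D2_sup b * sup_norm (grad f) = \<top>")
    case True
    then show ?thesis using h_pos by (simp add: mult.assoc ennreal_mult_top)
  next
    case False
    from lip_const_grad_euler_trans_le[OF f C this] show ?thesis by (simp add: mult.assoc)
  qed
  show "lip_const (grad ((P ^^ k) f)) \<le> ennreal (exp (C * (real k * h))) *
       (lip_const (grad f) + ennreal (real k * h) * D2_sup b * sup_norm (grad f))"
  proof (cases "D2_sup b * sup_norm (grad f) = \<top>")
    \<comment> \<open>For \<open>k = 0\<close> the time factor vanishes and
      \<open>0 * \<top> = 0\<close>, so the claim is the trivial bound for \<open>f\<close> itself;
      for \<open>k > 0\<close> the right-hand side is infinite.\<close>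
    case True
    then show ?thesis
      using h_pos by (cases "k = 0") (simp_all add: mult.assoc ennreal_mult_top)
  next
    case False
    have "(1 + C * h) ^ k \<le> exp (C * h) ^ k"
      using C0 h_pos exp_ge_add_one_self[of "C * h"] by (intro power_mono) auto
    also have "\<dots> = exp (C * (real k * h))"
      by (simp add: exp_of_nat_mult[symmetric] mult_ac)
    finally have "ennreal ((1 + C * h) ^ k) * (lip_const (grad f) + ennreal (real k * h) * (D2_sup b * sup_norm (grad f)))
      \<le> ennreal (exp (C * (real k * h))) * (lip_const (grad f) + ennreal (real k * h) * (D2_sup b * sup_norm (grad f)))"
      by (intro mult_right_mono ennreal_leI) auto
    with iterate_bounds[OF f C False, of k] show ?thesis by (simp only: mult.assoc) (meson order_trans)
  qed
qed

end

section \<open>From suprema of operator norms to pointwise bounds, and the theorem\<close>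

lemma norm_fderiv_matrix_vector_le:
  fixes s :: "real^'d \<Rightarrow> real^'q^'d"
  assumes "D_sup_opnorm s \<le> ennreal K" "K \<ge> 0"
  shows "norm (fderiv s x u *v z) \<le> K * norm u * norm z"
proof (cases "u = 0")
  case False
  \<comment> \<open>The supremum runs over the unit ball, so \<open>u\<close> is normalised first
    and the bound extended by homogeneity.\<close>
  have "ennreal (onorm ((*v) (fderiv s x (sgn u)))) \<le> D_sup_opnorm s"
    unfolding D_sup_opnorm_def using False
    by (intro SUP_upper2[of x] SUP_upper2[of "sgn u"]) (auto simp: norm_sgn)
  then have "ennreal (onorm ((*v) (fderiv s x (sgn u)))) \<le> ennreal K" using assms(1) by (rule order_trans)
  then have "onorm ((*v) (fderiv s x (sgn u))) \<le> K" using assms(2) by simp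
  then have *: "norm (fderiv s x (sgn u) *v z) \<le> K * norm z"
    by (rule order_trans[OF onorm mult_right_mono, rotated]) auto
  have u: "norm u *\<^sub>R sgn u = u" using False by (simp add: sgn_div_norm)
  have "norm (fderiv s x (norm u *\<^sub>R sgn u) *v z) = norm u * norm (fderiv s x (sgn u) *v z)"
    by (simp only: blinfun.scaleR_right matrix_vector_mult.scaleR_left norm_scaleR abs_norm_cancel)
  then have "norm (fderiv s x u *v z) = norm u * norm (fderiv s x (sgn u) *v z)" unfolding u .
  also have "\<dots> \<le> norm u * (K * norm z)" using * by (intro mult_left_mono) auto
  finally show ?thesis by (simp add: mult_ac)
qed (use assms in simp)

lemma norm_matrix_vector_le_sup_opnorm:
  fixes A :: "'a \<Rightarrow> real^'q^'d"
  assumes "sup_opnorm A \<le> ennreal K" "K \<ge> 0"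
  shows "norm (A x *v w) \<le> K * norm w"
proof -
  have "ennreal (onorm ((*v) (A x))) \<le> sup_opnorm A"
    unfolding sup_opnorm_def by (intro SUP_upper) auto
  then have "ennreal (onorm ((*v) (A x))) \<le> ennreal K" using assms(1) by (rule order_trans)
  then have "onorm ((*v) (A x)) \<le> K" using assms(2) by simp
  then show ?thesis
    by (rule order_trans[OF onorm mult_right_mono, rotated]) auto
qed

text \<open>Integrability and differentiability of the iterates belong to the conclusion: they
  ensure that neither the default value of a divergent integral nor an undefined \<open>grad\<close>
  enters the inequalities.\<close>

theorem proposition3p2:
  fixes T M_Db M_D2b M_Ds M_D2ss :: real
  assumes "T > 0"
  shows "\<exists>C>0. \<forall>(n::nat) h. n \<ge> 1 \<longrightarrow> h = T / real n \<longrightarrow>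
    (\<forall>(b :: real^'d \<Rightarrow> real^'d) (\<sigma> :: real^'d \<Rightarrow> real^'q^'d).
      twice_differentiable b \<longrightarrow> twice_differentiable \<sigma> \<longrightarrow>
      sup_norm (fderiv b) \<le> ennreal M_Db \<longrightarrow>
      D2_sup b \<le> ennreal M_D2b \<longrightarrow>
      D_sup_opnorm \<sigma> \<le> ennreal M_Ds \<longrightarrow>
      (\<forall>i j. sup_opnorm (\<lambda>x. partial2 i j \<sigma> x ** transpose (\<sigma> x)) \<le> ennreal M_D2ss) \<longrightarrow>
      (\<forall>f :: real^'d \<Rightarrow> real.
        twice_differentiable f \<longrightarrow> (\<exists>L. L-lipschitz_on UNIV (grad f)) \<longrightarrow>
        (let P = euler_trans h b \<sigma> in
          (\<forall>k<n. \<forall>x. integrable std_gaussian (\<lambda>z. (P ^^ k) f (euler_step h b \<sigma> x z))) \<and>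
          (\<forall>k\<le>n. \<forall>x. (P ^^ k) f differentiable (at x)) \<and>
          lip_const (P f) \<le> ennreal (1 + C * h) * lip_const f \<and>
          lip_const (grad (P f)) \<le> ennreal (1 + C * h) * lip_const (grad f)
             + ennreal h * D2_sup b * sup_norm (grad f) \<and>
          (\<forall>k\<le>n. lip_const (grad ((P ^^ k) f)) \<le> ennreal (exp (C * (real k * h))) *
             (lip_const (grad f) + ennreal (real k * h) * D2_sup b * sup_norm (grad f))))))"
proof -
  \<comment> \<open>\<open>ennreal\<close> sends negative reals to \<open>0\<close>, so truncating
    the bounds at \<open>0\<close> leaves the assumptions unchanged.\<close>
  define Kb where "Kb = max 0 M_Db"
  define Ks where "Ks = max 0 M_Ds"
  define K2 where "K2 = max 0 M_D2ss"
  have K: "Kb \<ge> 0" "Ks \<ge> 0" "K2 \<ge> 0" by (auto simp: Kb_def Ks_def K2_def)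
  have e: "ennreal (max 0 r) = ennreal r" for r :: real
    by (simp add: max_def ennreal_neg)
  \<comment> \<open>The rate increases with the step, so its value at \<open>T\<close> serves every
    \<open>h \<le> T\<close>; the summand \<open>1\<close> makes \<open>C\<close> positive even when
    all bounds vanish.\<close>
  define C where "C = moment_rate CARD('q) T Kb Ks + real CARD('d) ^ 3 * K2 + 1"
  show ?thesis
  proof (intro exI[of _ C] conjI allI impI)
    show "C > 0" using K assms by (simp add: C_def moment_rate_def add_nonneg_pos)
    fix n :: nat and h :: real and b :: "real^'d \<Rightarrow> real^'d" and \<sigma> :: "real^'d \<Rightarrow> real^'q^'d"
      and f :: "real^'d \<Rightarrow> real"
    assume n: "1 \<le> n" and h: "h = T / real n"
      and b: "twice_differentiable b" and \<sigma>: "twice_differentiable \<sigma>"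
      and Db: "sup_norm (fderiv b) \<le> ennreal M_Db"
      and Ds: "D_sup_opnorm \<sigma> \<le> ennreal M_Ds"
      and D2s: "\<forall>i j. sup_opnorm (\<lambda>x. partial2 i j \<sigma> x ** transpose (\<sigma> x)) \<le> ennreal M_D2ss"
      and f: "twice_differentiable f" "\<exists>L. L-lipschitz_on UNIV (grad f)"
    have h0: "h > 0" using n h assms by simp
    have hT: "h \<le> T" using n h assms by (simp add: divide_le_eq mult_le_cancel_left1)
    interpret euler_scheme h b \<sigma> Kb Ks K2
    proof
      fix x u
      have "norm (fderiv b x) \<le> Kb"
        using Db K(1) sup_norm_le_iff[of Kb "fderiv b"] by (simp add: Kb_def e)
      then show "norm (fderiv b x u) \<le> Kb * norm u"
        by (rule order_trans[OF norm_blinfun mult_right_mono]) auto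
    next
      show "norm (fderiv \<sigma> x u *v z) \<le> Ks * norm u * norm z" for x u z
        using Ds K by (intro norm_fderiv_matrix_vector_le) (auto simp: Ks_def e)
      show "norm ((partial2 i j \<sigma> x ** transpose (\<sigma> x)) *v w) \<le> K2 * norm w" for i j x w
        by (rule norm_matrix_vector_le_sup_opnorm[where A = "\<lambda>x. partial2 i j \<sigma> x ** transpose (\<sigma> x)"])
           (use D2s K in \<open>simp_all add: K2_def e\<close>)
    qed (use h0 b \<sigma> K in auto)
    have "moment_rate CARD('q) h Kb Ks \<le> moment_rate CARD('q) T Kb Ks"
      using hT by (simp add: moment_rate_def mult_right_mono)
    then have C: "moment_rate CARD('q) h Kb Ks + real CARD('d) ^ 3 * K2 \<le> C" by (simp add: C_def)
    obtain L where L: "regular_grad f (grad f) L"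
      using f(2) regular_grad_of_twice_differentiable[OF f(1)] by auto
    note est = euler_scheme_estimates[OF L C]
    have 1: "\<forall>k<n. \<forall>x. integrable std_gaussian (\<lambda>z. (P ^^ k) f (E x z))"
      by (intro allI impI) (rule est(1))
    have 2: "\<forall>k\<le>n. \<forall>x. (P ^^ k) f differentiable (at x)"
      by (intro allI impI) (rule est(2))
    have 5: "\<forall>k\<le>n. lip_const (grad ((P ^^ k) f)) \<le> ennreal (exp (C * (real k * h))) *
             (lip_const (grad f) + ennreal (real k * h) * D2_sup b * sup_norm (grad f))"
      by (intro allI impI) (rule est(5))
    show "let P = euler_trans h b \<sigma> in
          (\<forall>k<n. \<forall>x. integrable std_gaussian (\<lambda>z. (P ^^ k) f (euler_step h b \<sigma> x z))) \<and>
          (\<forall>k\<le>n. \<forall>x. (P ^^ k) f differentiable (at x)) \<and>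
          lip_const (P f) \<le> ennreal (1 + C * h) * lip_const f \<and>
          lip_const (grad (P f)) \<le> ennreal (1 + C * h) * lip_const (grad f)
             + ennreal h * D2_sup b * sup_norm (grad f) \<and>
          (\<forall>k\<le>n. lip_const (grad ((P ^^ k) f)) \<le> ennreal (exp (C * (real k * h))) *
             (lip_const (grad f) + ennreal (real k * h) * D2_sup b * sup_norm (grad f)))"
      unfolding Let_def by (rule conjI[OF 1 conjI[OF 2 conjI[OF est(3) conjI[OF est(4) 5]]]])

  qed
qed

end
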